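(* Let $N\in\mathbb{N}_0$, let $W\in W^{N+3,\infty}_{\mathrm{loc}}(\mathbb{R})$ be complex-valued, and let $\mu>0$, $x_0\in\mathbb{R}$. Assume that there exists a neighborhood $I$ of $x_0$ such that the function $x\mapsto\operatorname{Im}W(x)-\operatorname{Im}W(x_0)$ changes its sign at the point $x_0$ on $I$. Fix $z=\mu+W(x_0)$. Then there exist $h_0>0$ and a family $\Psi_{h,N}\in\mathrm{Dom}(H_h)$ such that for all $h\in(0,h_0)$, $$\frac{\|(H_h-z)\Psi_{h,N}\|}{\|\Psi_{h,N}\|}\lesssim h^{N+1}.$$
   Context: For $h>0$, $H_h=h^4\frac{d^4}{dx^4}+W(x)$ is the semi-classical biharmonic operator in $L^2(\mathbb{R})$ with maximal domain $\mathrm{Dom}(H_h)=\{u\in L^2(\mathbb{R}):\ (h^4\frac{d^4}{dx^4}+W)u\in L^2(\mathbb{R})\}$ (in the sense of distributions). $\|\cdot\|$ is the $L^2(\mathbb{R})$ norm. $\lesssim$ means inequality up to a multiplicative constant independent of $h$. "Changes its sign at $x_0$ on $I$" means that $\operatorname{Im}W(x)-\operatorname{Im}W(x_0)$ is strictly negative on one of the sets $I\cap(-\infty,x_0)$, $I\cap(x_0,\infty)$ and strictly positive on the other. *)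

theory Defs
  imports "HOL-Analysis.Analysis"
begin

text \<open>Complex-valued functions on the real line; elements of the Lebesgue and Sobolev spaces are
  represented by Lebesgue measurable functions rather than by classes modulo null sets.\<close>

definition test_functions :: "(real \<Rightarrow> complex) set" where
  "test_functions =
     {\<phi>. (\<forall>k x. ((\<lambda>f t. vector_derivative f (at t)) ^^ k) \<phi> differentiable (at x)) \<and>
          compact (closure {x. \<phi> x \<noteq> 0})}"

text \<open>A distribution is represented by its action on test functions; its values on other
  functions are irrelevant and never used. The pairing is bilinear (no conjugation).\<close>

type_synonym distribution = "(real \<Rightarrow> complex) \<Rightarrow> complex"

definition regular_dist :: "(real \<Rightarrow> complex) \<Rightarrow> distribution" where
  "regular_dist u = (\<lambda>\<phi>. LINT x|lebesgue. u x * \<phi> x)"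

definition dist_deriv :: "distribution \<Rightarrow> distribution" where
  "dist_deriv T = (\<lambda>\<phi>. - T (\<lambda>x. vector_derivative \<phi> (at x)))"

definition dist_eq :: "distribution \<Rightarrow> distribution \<Rightarrow> bool" where
  "dist_eq S T \<longleftrightarrow> (\<forall>\<phi>\<in>test_functions. S \<phi> = T \<phi>)"

definition Linf_loc :: "(real \<Rightarrow> complex) set" where
  "Linf_loc = {v. v \<in> borel_measurable lebesgue \<and>
     (\<forall>K. compact K \<longrightarrow> (\<exists>B. AE x in lebesgue. x \<in> K \<longrightarrow> norm (v x) \<le> B))}"

text \<open>Membership does not depend on the representative. For m at least 1 every element has a
  unique continuous representative, which has to be used whenever point values matter.\<close>

definition Winf_loc :: "nat \<Rightarrow> (real \<Rightarrow> complex) set" where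
  "Winf_loc m = {w \<in> Linf_loc.
     \<forall>k\<le>m. \<exists>v\<in>Linf_loc. dist_eq ((dist_deriv ^^ k) (regular_dist w)) (regular_dist v)}"

definition L2 :: "(real \<Rightarrow> complex) set" where
  "L2 = {u \<in> borel_measurable lebesgue. integrable lebesgue (\<lambda>x. (norm (u x))\<^sup>2)}"

definition L2_norm :: "(real \<Rightarrow> complex) \<Rightarrow> real" where
  "L2_norm u = sqrt (LINT x|lebesgue. (norm (u x))\<^sup>2)"

definition biharmonic_dist :: "real \<Rightarrow> (real \<Rightarrow> complex) \<Rightarrow> (real \<Rightarrow> complex) \<Rightarrow> distribution" where
  "biharmonic_dist h W u =
     (\<lambda>\<phi>. of_real (h ^ 4) * (dist_deriv ^^ 4) (regular_dist u) \<phi>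
           + regular_dist (\<lambda>x. W x * u x) \<phi>)"

definition biharmonic_dom :: "real \<Rightarrow> (real \<Rightarrow> complex) \<Rightarrow> (real \<Rightarrow> complex) set" where
  "biharmonic_dom h W =
     {u \<in> L2. \<exists>f\<in>L2. dist_eq (biharmonic_dist h W u) (regular_dist f)}"

text \<open>On the domain, the chosen function is determined up to a null set, since a locally
  integrable function is determined almost everywhere by its distribution. In particular
  its \<open>L2_norm\<close> does not depend on the choice.\<close>

definition biharmonic_op :: "real \<Rightarrow> (real \<Rightarrow> complex) \<Rightarrow> (real \<Rightarrow> complex) \<Rightarrow> real \<Rightarrow> complex" where
  "biharmonic_op h W u =
     (SOME f. f \<in> L2 \<and> dist_eq (biharmonic_dist h W u) (regular_dist f))"

definition changes_sign_at :: "(real \<Rightarrow> real) \<Rightarrow> real \<Rightarrow> real set \<Rightarrow> bool" where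
  "changes_sign_at g x\<^sub>0 I \<longleftrightarrow>
     ((\<forall>x \<in> I \<inter> {..<x\<^sub>0}. g x < 0) \<and> (\<forall>x \<in> I \<inter> {x\<^sub>0<..}. g x > 0)) \<or>
     ((\<forall>x \<in> I \<inter> {..<x\<^sub>0}. g x > 0) \<and> (\<forall>x \<in> I \<inter> {x\<^sub>0<..}. g x < 0))"

end

theory Submission
  imports Defs
begin

text \<open>The quasimode is a WKB function \<open>\<Psi> = \<eta> exp (\<phi> / h)\<close> with a cutoff \<open>\<eta>\<close> around \<open>x\<^sub>0\<close>. Writing
\<open>a\<^sub>0 = \<phi>'\<close> and \<open>a\<^sub>k = h\<^sup>k (d\<^sup>k/dx\<^sup>k) a\<^sub>0\<close>, four differentiations of the exponential give
\<open>h\<^sup>4 (d\<^sup>4/dx\<^sup>4) exp (\<phi> / h) = (a\<^sub>0\<^sup>4 + 6 a\<^sub>0\<^sup>2 a\<^sub>1 + 4 a\<^sub>0 a\<^sub>2 + 3 a\<^sub>1\<^sup>2 + a\<^sub>3) exp (\<phi> / h)\<close>,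
so the task is to solve the Riccati-type equation that sets this factor equal to \<open>z - W\<close>, up to
\<open>O(h^(N + 1))\<close>. Take \<open>a\<^sub>0\<close> to be a polynomial in \<open>h\<close> of degree \<open>N\<close>. Its coefficient of order 0 is a
fourth root of \<open>z - W\<close>, and since the linearisation of the equation at the root \<open>c\<close> is
multiplication by \<open>4 c\<^sup>3\<close>, each further coefficient comes from the previous ones by algebra and
differentiation alone (\<open>formal_wkb_solution\<close>). Every power of \<open>h\<close> costs one derivative of \<open>W\<close>, the
last coefficient is differentiated three times, and this uses up exactly the \<open>N + 3\<close> weak derivatives
of \<open>W\<close>.

Localisation comes from the sign change. Near \<open>x\<^sub>0\<close> the values of \<open>z - W\<close> lie in the right
half-plane, and one of the two fourth roots \<open>\<i>\<close> and \<open>- \<i>\<close> times the principal one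
has a real part that is positive to the left of \<open>x\<^sub>0\<close> and negative to the right. Hence \<open>Re \<phi>\<close> has, up to
\<open>O(h)\<close>, a strict maximum at \<open>x\<^sub>0\<close>: where the derivatives of the cutoff live, \<open>exp (\<phi> / h)\<close> is
exponentially small, while it is bounded below on an interval of length \<open>2 h\<close> around \<open>x\<^sub>0\<close>. A
crude lower bound of \<open>\<parallel>\<Psi>\<parallel>\<^sup>2\<close> by a multiple of \<open>h\<close> therefore suffices (\<open>quasimode_of_root\<close>).

Two points come from the weak formulation. First, \<open>W\<close> is only assumed to have distributional
derivatives. By the du Bois-Reymond lemma it is an \<open>(N + 3)\<close>-fold indefinite integral of a locally
bounded function (\<open>Winf_loc_imp_sobolev\<close>), and all the calculus is carried out for such iterated
primitives. The product rule for them (\<open>primitive_mult\<close>) rests on a quadratic bound of increments.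
Secondly, the operator is defined by choosing an arbitrary representative of a distribution, which the fundamental lemma of the calculus of variations shows to be determined
almost everywhere (\<open>biharmonic_op_compact_support\<close>).\<close>

section \<open>Primitives of locally bounded functions\<close>

definition loc_bounded :: "(real \<Rightarrow> complex) \<Rightarrow> bool" where
  "loc_bounded g \<longleftrightarrow>
     g \<in> borel_measurable lebesgue \<and> (\<forall>R. \<exists>B. \<forall>x. \<bar>x\<bar> \<le> R \<longrightarrow> norm (g x) \<le> B)"

text \<open>Functions with a locally bounded weak derivative \<open>g\<close>, in integrated form. This is a relation,
since \<open>g\<close> is determined only up to a null set.\<close>
definition primitive :: "(real \<Rightarrow> complex) \<Rightarrow> (real \<Rightarrow> complex) \<Rightarrow> bool" where
  "primitive f g \<longleftrightarrow> loc_bounded g \<and> (\<forall>x y. x \<le> y \<longrightarrow> (g has_integral (f y - f x)) {x..y})"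

lemma loc_bounded_bound:
  assumes "loc_bounded g"
  obtains B where "B > 0" "\<And>x. \<bar>x\<bar> \<le> R \<Longrightarrow> norm (g x) \<le> B"
proof -
  obtain B where "\<forall>x. \<bar>x\<bar> \<le> R \<longrightarrow> norm (g x) \<le> B"
    using assms unfolding loc_bounded_def by blast
  then show ?thesis
    by (intro that[of "\<bar>B\<bar> + 1"]) fastforce+
qed

lemma loc_bounded_const [simp]: "loc_bounded (\<lambda>x. c)"
  unfolding loc_bounded_def by auto

lemma loc_bounded_add:
  assumes "loc_bounded f" "loc_bounded g"
  shows "loc_bounded (\<lambda>x. f x + g x)"
  unfolding loc_bounded_def
proof (intro conjI allI)
  show "(\<lambda>x. f x + g x) \<in> borel_measurable lebesgue"
    using assms unfolding loc_bounded_def by auto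
  fix R
  obtain A where A: "\<And>x. \<bar>x\<bar> \<le> R \<Longrightarrow> norm (f x) \<le> A"
    using loc_bounded_bound[OF assms(1)] by metis
  obtain B where B: "\<And>x. \<bar>x\<bar> \<le> R \<Longrightarrow> norm (g x) \<le> B"
    using loc_bounded_bound[OF assms(2)] by metis
  show "\<exists>B. \<forall>x. \<bar>x\<bar> \<le> R \<longrightarrow> norm (f x + g x) \<le> B"
    using A B by (intro exI[of _ "A + B"]) (auto intro!: norm_triangle_mono)
qed

lemma loc_bounded_mult:
  assumes "loc_bounded f" "loc_bounded g"
  shows "loc_bounded (\<lambda>x. f x * g x)"
  unfolding loc_bounded_def
proof (intro conjI allI)
  show "(\<lambda>x. f x * g x) \<in> borel_measurable lebesgue"
    using assms unfolding loc_bounded_def by auto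
  fix R
  obtain A where A: "A > 0" "\<And>x. \<bar>x\<bar> \<le> R \<Longrightarrow> norm (f x) \<le> A"
    using loc_bounded_bound[OF assms(1)] by metis
  obtain B where B: "\<And>x. \<bar>x\<bar> \<le> R \<Longrightarrow> norm (g x) \<le> B"
    using loc_bounded_bound[OF assms(2)] by metis
  show "\<exists>B. \<forall>x. \<bar>x\<bar> \<le> R \<longrightarrow> norm (f x * g x) \<le> B"
    using A B by (intro exI[of _ "A * B"]) (auto simp: norm_mult intro!: mult_mono)
qed

lemma loc_bounded_uminus: "loc_bounded f \<Longrightarrow> loc_bounded (\<lambda>x. - f x)"
  using loc_bounded_mult[OF loc_bounded_const[of "-1"], of f] by simp

lemma loc_bounded_diff: "loc_bounded f \<Longrightarrow> loc_bounded g \<Longrightarrow> loc_bounded (\<lambda>x. f x - g x)"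
  using loc_bounded_add[OF _ loc_bounded_uminus, of f g] by simp

lemma loc_bounded_power: "loc_bounded f \<Longrightarrow> loc_bounded (\<lambda>x. f x ^ n)"
  by (induction n) (auto intro: loc_bounded_mult)

lemma loc_bounded_divide_const: "loc_bounded f \<Longrightarrow> loc_bounded (\<lambda>x. f x / c)"
  using loc_bounded_mult[OF loc_bounded_const[of "inverse c"], of f] by (simp add: divide_inverse mult.commute)

lemma continuous_imp_loc_bounded:
  assumes "continuous_on UNIV f"
  shows "loc_bounded f"
  unfolding loc_bounded_def
proof (intro conjI allI)
  show "f \<in> borel_measurable lebesgue"
    using borel_measurable_continuous_onI[OF assms] by (simp add: measurable_completion)
  fix R
  have "compact (f ` {-R..R})"
    using assms by (intro compact_continuous_image continuous_on_subset[OF assms]) auto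
  then obtain B where "\<forall>y \<in> f ` {-R..R}. norm y \<le> B"
    using compact_imp_bounded bounded_iff by metis
  then show "\<exists>B. \<forall>x. \<bar>x\<bar> \<le> R \<longrightarrow> norm (f x) \<le> B"
    by (intro exI[of _ B]) (auto simp: abs_le_iff)
qed

lemma loc_bounded_absolutely_integrable:
  assumes "loc_bounded g"
  shows "g absolutely_integrable_on {a..b}"
proof -
  obtain B where B: "\<And>x. \<bar>x\<bar> \<le> \<bar>a\<bar> + \<bar>b\<bar> \<Longrightarrow> norm (g x) \<le> B"
    using loc_bounded_bound[OF assms] by metis
  have "g \<in> borel_measurable (lebesgue_on {a..b})"
    using assms measurable_restrict_space1 unfolding loc_bounded_def by blast
  then show ?thesis
    by (rule measurable_bounded_by_integrable_imp_absolutely_integrable[where g = "\<lambda>_. B"])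
      (auto intro!: B integrable_const_ivl)
qed

lemma loc_bounded_integrable_on: "loc_bounded g \<Longrightarrow> g integrable_on {a..b}"
  using loc_bounded_absolutely_integrable absolutely_integrable_on_def by blast

lemma loc_bounded_integral_eq:
  assumes "loc_bounded g" "\<And>x. \<bar>x\<bar> > R \<Longrightarrow> g x = 0"
  shows "integrable lebesgue g" "(LINT x|lebesgue. g x) = integral {-R..R} g"
proof -
  have eq: "(\<lambda>x. indicator {-R..R} x *\<^sub>R g x) = g"
    using assms(2) by (auto simp: indicator_def fun_eq_iff)
  have ai: "set_integrable lebesgue {-R..R} g"
    using loc_bounded_absolutely_integrable[OF assms(1)] .
  show "integrable lebesgue g" using ai unfolding set_integrable_def eq .
  show "(LINT x|lebesgue. g x) = integral {-R..R} g"
    using set_lebesgue_integral_eq_integral(2)[OF ai] unfolding set_lebesgue_integral_def eq .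
qed

lemma primitive_loc_bounded: "primitive f g \<Longrightarrow> loc_bounded g"
  by (simp add: primitive_def)

lemma primitiveD: "primitive f g \<Longrightarrow> x \<le> y \<Longrightarrow> (g has_integral (f y - f x)) {x..y}"
  by (simp add: primitive_def)

lemma has_integral_bound_interval:
  fixes g :: "real \<Rightarrow> complex"
  assumes "(g has_integral i) {x..y}" "x \<le> y" "0 \<le> B" "\<And>t. t \<in> {x..y} \<Longrightarrow> norm (g t) \<le> B"
  shows "norm i \<le> B * (y - x)"
  using has_integral_bound_real[where S = "{}", OF assms(3) _ assms(1)] assms by auto

lemma primitive_lipschitz:
  assumes "primitive f g"
  obtains L where "L > 0" "\<And>x y. \<bar>x\<bar> \<le> R \<Longrightarrow> \<bar>y\<bar> \<le> R \<Longrightarrow> norm (f y - f x) \<le> L * \<bar>y - x\<bar>"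
proof -
  obtain L where L: "L > 0" "\<And>x. \<bar>x\<bar> \<le> R \<Longrightarrow> norm (g x) \<le> L"
    using loc_bounded_bound[OF primitive_loc_bounded[OF assms]] by metis
  have *: "norm (f y - f x) \<le> L * \<bar>y - x\<bar>" if "\<bar>x\<bar> \<le> R" "\<bar>y\<bar> \<le> R" "x \<le> y" for x y
    using has_integral_bound_interval[OF primitiveD[OF assms that(3)] that(3), of L] L that
    by (simp add: abs_le_iff)
  show ?thesis
  proof (rule that[OF L(1)])
    fix x y assume "\<bar>x\<bar> \<le> R" "\<bar>y\<bar> \<le> R"
    then show "norm (f y - f x) \<le> L * \<bar>y - x\<bar>"
      using *[of x y] *[of y x] by (cases "x \<le> y") (auto simp: norm_minus_commute abs_minus_commute)
  qed
qed

lemma primitive_continuous: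
  assumes "primitive f g"
  shows "continuous_on UNIV f"
proof -
  have "isCont f x" for x
  proof -
    obtain L where L: "L > 0" 
      "\<And>u v. \<bar>u\<bar> \<le> \<bar>x\<bar> + 1 \<Longrightarrow> \<bar>v\<bar> \<le> \<bar>x\<bar> + 1 \<Longrightarrow> norm (f v - f u) \<le> L * \<bar>v - u\<bar>"
      using primitive_lipschitz[OF assms] by metis
    have "((\<lambda>y. f y - f x) \<longlongrightarrow> 0) (at x)"
    proof (rule Lim_null_comparison)
      show "\<forall>\<^sub>F y in at x. norm (f y - f x) \<le> L * \<bar>y - x\<bar>"
        unfolding eventually_at
        by (intro exI[of _ 1]) (auto simp: dist_real_def intro!: L(2))
      show "((\<lambda>y. L * \<bar>y - x\<bar>) \<longlongrightarrow> 0) (at x)"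
        by (auto intro!: tendsto_eq_intros)
    qed
    then show ?thesis by (simp add: isCont_def LIM_zero_iff)
  qed
  then show ?thesis by (simp add: continuous_on_eq_continuous_at)
qed

lemma primitive_imp_loc_bounded: "primitive f g \<Longrightarrow> loc_bounded f"
  using primitive_continuous continuous_imp_loc_bounded by blast

lemma primitive_const: "primitive (\<lambda>x. c) (\<lambda>x. 0)"
  by (simp add: primitive_def)

lemma primitive_add:
  "primitive f f' \<Longrightarrow> primitive g g' \<Longrightarrow> primitive (\<lambda>x. f x + g x) (\<lambda>x. f' x + g' x)"
  unfolding primitive_def
  using has_integral_add[of f' "f _ - f _" _ g' "g _ - g _"]
  by (auto intro!: loc_bounded_add simp: add_diff_add)

text \<open>A function whose increments are quadratically small has derivative zero.
The criterion covers indefinite integrals of discontinuous functions, where no pointwise derivative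
is at hand.\<close>
lemma zero_derivative_of_quadratic_bound:
  fixes F :: "real \<Rightarrow> complex"
  assumes "\<And>x y. \<bar>x\<bar> \<le> R \<Longrightarrow> \<bar>y\<bar> \<le> R \<Longrightarrow> x \<le> y \<Longrightarrow> norm (F y - F x) \<le> C * (y - x)\<^sup>2"
    and "\<bar>a\<bar> \<le> R" "\<bar>b\<bar> \<le> R"
  shows "F a = F b"
proof -
  have C: "norm (F y - F x) \<le> C * \<bar>y - x\<bar> * \<bar>y - x\<bar>" if "x \<in> {-R..R}" "y \<in> {-R..R}" for x y
    using assms(1)[of x y] assms(1)[of y x] that
    by (cases "x \<le> y") (auto simp: norm_minus_commute power2_eq_square mult.assoc)
  have "(F has_derivative (\<lambda>_. 0)) (at x within {-R..R})" if x: "x \<in> {-R..R}" for x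
  proof (rule has_derivativeI_sandwich[of 1])
    show "bounded_linear (\<lambda>_::real. 0::complex)" by simp
    show "norm (F y - F x - 0) / norm (y - x) \<le> C * \<bar>y - x\<bar>"
      if "y \<in> {-R..R}" "y \<noteq> x" "dist y x < 1" for y
      using C[OF x that(1)] that by (simp add: divide_simps)
    show "((\<lambda>y. C * \<bar>y - x\<bar>) \<longlongrightarrow> 0) (at x within {-R..R})"
      by (rule tendsto_eq_intros refl | simp)+
  qed simp
  then show ?thesis
    using has_derivative_zero_unique[of "{-R..R}" F] assms(2,3)
    by (metis abs_le_iff atLeastAtMost_iff convex_real_interval(5) minus_le_iff)
qed

text \<open>On \<open>{x..y}\<close> the increment of \<open>f g\<close> is the integral of \<open>f' g(y) + f(x) g'\<close>. Replacing \<open>g(y)\<close> and \<open>f(x)\<close>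
by \<open>g(t)\<close> and \<open>f(t)\<close> costs \<open>O((y - x)\<^sup>2)\<close> because \<open>f\<close> and \<open>g\<close> are locally Lipschitz. So the
difference between \<open>f g\<close> and the indefinite integral of \<open>f' g + f g'\<close> has quadratically small
increments and is constant.\<close>
lemma primitive_mult:
  assumes f: "primitive f f'" and g: "primitive g g'"
  shows "primitive (\<lambda>x. f x * g x) (\<lambda>x. f' x * g x + f x * g' x)"
proof -
  define k where "k = (\<lambda>x. f' x * g x + f x * g' x)"
  note lb = primitive_loc_bounded[OF f] primitive_loc_bounded[OF g]
    primitive_imp_loc_bounded[OF f] primitive_imp_loc_bounded[OF g]
  have k: "loc_bounded k"
    unfolding k_def by (intro loc_bounded_add loc_bounded_mult lb)
  have "(k has_integral (f b * g b - f a * g a)) {a..b}" if "a \<le> b" for a b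
  proof -
    define R where "R = \<bar>a\<bar> + \<bar>b\<bar>"
    define F where "F x = f x * g x - integral {-R..x} k" for x
    obtain L where L: "L > 0" "\<And>u v. \<bar>u\<bar> \<le> R \<Longrightarrow> \<bar>v\<bar> \<le> R \<Longrightarrow> norm (f v - f u) \<le> L * \<bar>v - u\<bar>"
      using primitive_lipschitz[OF f] by metis
    obtain M where M: "M > 0" "\<And>u v. \<bar>u\<bar> \<le> R \<Longrightarrow> \<bar>v\<bar> \<le> R \<Longrightarrow> norm (g v - g u) \<le> M * \<bar>v - u\<bar>"
      using primitive_lipschitz[OF g] by metis
    obtain A where A: "A > 0" "\<And>x. \<bar>x\<bar> \<le> R \<Longrightarrow> norm (f' x) \<le> A"
      using loc_bounded_bound[OF lb(1)] by metis
    obtain B where B: "B > 0" "\<And>x. \<bar>x\<bar> \<le> R \<Longrightarrow> norm (g' x) \<le> B"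
      using loc_bounded_bound[OF lb(2)] by metis
    have bnd: "norm (F y - F x) \<le> (A * M + L * B) * (y - x)\<^sup>2"
      if xy: "\<bar>x\<bar> \<le> R" "\<bar>y\<bar> \<le> R" "x \<le> y" for x y
    proof -
      have "((\<lambda>t. f' t * g y + f x * g' t) has_integral
          ((f y - f x) * g y + f x * (g y - g x))) {x..y}"
        by (intro has_integral_add has_integral_mult_left has_integral_mult_right
            primitiveD[OF f] primitiveD[OF g] xy)
      moreover have kint: "(k has_integral integral {x..y} k) {x..y}"
        using loc_bounded_integrable_on[OF k] by blast
      ultimately have "((\<lambda>t. (f' t * g y + f x * g' t) - k t) has_integral
          ((f y - f x) * g y + f x * (g y - g x) - integral {x..y} k)) {x..y}"
        by (rule has_integral_diff)
      moreover have comb: "integral {-R..x} k + integral {x..y} k = integral {-R..y} k"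
        using xy by (intro Henstock_Kurzweil_Integration.integral_combine
            loc_bounded_integrable_on[OF k]) auto
      then have "(f y - f x) * g y + f x * (g y - g x) - integral {x..y} k = F y - F x"
        unfolding F_def by (simp add: algebra_simps)
      ultimately have hi: "((\<lambda>t. (f' t * g y + f x * g' t) - k t) has_integral (F y - F x)) {x..y}"
        by simp
      have "norm (F y - F x) \<le> ((A * M + L * B) * (y - x)) * (y - x)"
      proof (rule has_integral_bound_interval[OF hi])
        show "0 \<le> (A * M + L * B) * (y - x)" using A B L M xy by auto
        fix t assume t: "t \<in> {x..y}"
        then have tR: "\<bar>t\<bar> \<le> R" using xy by auto
        have "norm (f' t * (g y - g t) + (f x - f t) * g' t)
            \<le> norm (f' t) * norm (g y - g t) + norm (f x - f t) * norm (g' t)"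
          by (metis norm_mult norm_triangle_ineq)
        also have "\<dots> \<le> A * (M * \<bar>y - t\<bar>) + (L * \<bar>x - t\<bar>) * B"
          using A B L M xy tR by (intro add_mono mult_mono) auto
        also have "\<dots> \<le> A * (M * (y - x)) + (L * (y - x)) * B"
          using A B L M t by (intro add_mono mult_mono mult_left_mono) auto
        finally show "norm ((f' t * g y + f x * g' t) - k t) \<le> (A * M + L * B) * (y - x)"
          unfolding k_def by (simp add: algebra_simps)
      qed (use xy in auto)
      then show ?thesis by (simp add: power2_eq_square mult.assoc)
    qed
    have "F a = F b"
      by (rule zero_derivative_of_quadratic_bound[of R F, OF bnd]) (auto simp: R_def)
    moreover have "integral {-R..a} k + integral {a..b} k = integral {-R..b} k"
      using that by (intro Henstock_Kurzweil_Integration.integral_combine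
          loc_bounded_integrable_on[OF k]) (auto simp: R_def)
    ultimately have "integral {a..b} k = f b * g b - f a * g a"
      unfolding F_def by algebra
    then show ?thesis
      using loc_bounded_integrable_on[OF k, of a b] by (metis integrable_integral)
  qed
  then show ?thesis
    using k unfolding primitive_def k_def by auto
qed

lemma primitive_cmult: "primitive f g \<Longrightarrow> primitive (\<lambda>x. c * f x) (\<lambda>x. c * g x)"
  using primitive_mult[OF primitive_const[of c], of f g] by simp

lemma primitive_divide_const: "primitive f g \<Longrightarrow> primitive (\<lambda>x. f x / c) (\<lambda>x. g x / c)"
  using primitive_cmult[of f g "inverse c"] by (simp add: divide_inverse mult.commute)

lemma primitive_integral:
  assumes "loc_bounded g"
  shows "\<exists>f. primitive f g \<and> f a = 0"
proof -
  define f where "f x = (if a \<le> x then integral {a..x} g else - integral {x..a} g)" for x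
  note int = loc_bounded_integrable_on[OF assms]
  have comb: "integral {x..y} g + integral {y..z} g = integral {x..z} g" if "x \<le> y" "y \<le> z" for x y z
    using that int by (intro Henstock_Kurzweil_Integration.integral_combine) auto
  have "f y - f x = integral {x..y} g" if "x \<le> y" for x y
    using comb[of a x y] comb[of x a y] comb[of x y a] that unfolding f_def
    by (auto simp: algebra_simps)
  then have "primitive f g"
    using assms int unfolding primitive_def by auto
  then show ?thesis by (intro exI[of _ f]) (simp add: f_def)
qed

lemma primitive_of_derivative:
  assumes "\<And>x. (f has_vector_derivative g x) (at x)" "loc_bounded g"
  shows "primitive f g"
  unfolding primitive_def
  using assms by (auto intro!: fundamental_theorem_of_calculus
      intro: has_vector_derivative_at_within)

lemma primitive_has_derivative:
  assumes f: "primitive f g" and g: "continuous_on UNIV g"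
  shows "(f has_vector_derivative g x) (at x)"
proof -
  define a where "a = x - 1"
  have "((\<lambda>u. integral {a..u} g) has_vector_derivative g x) (at x within {a..x+1})"
    by (rule integral_has_vector_derivative) (auto intro: continuous_on_subset[OF g] simp: a_def)
  then have "((\<lambda>u. f a + integral {a..u} g) has_vector_derivative g x) (at x within {a..x+1})"
    by (auto intro!: derivative_eq_intros)
  then have "((\<lambda>u. f a + integral {a..u} g) has_vector_derivative g x) (at x)"
    by (simp add: at_within_Icc_at a_def)
  then show ?thesis
  proof (rule has_vector_derivative_transform_within_open[where S = "{a<..}"])
    fix u assume "u \<in> {a<..}"
    then show "f a + integral {a..u} g = f u"
      using integral_unique[OF primitiveD[OF f, of a u]] by simp
  qed (auto simp: a_def)
qed

section \<open>Local Sobolev functions as iterated primitives\<close>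

text \<open>The continuous representatives of the elements of the local Sobolev space of order \<open>k\<close> and exponent
\<open>\<infinity>\<close>, for \<open>k\<close> at least 1. A function that satisfies this for all \<open>k\<close> is smooth, so the same predicate also
serves for test functions and cutoffs.\<close>
fun sobolev :: "nat \<Rightarrow> (real \<Rightarrow> complex) \<Rightarrow> bool" where
  "sobolev 0 f \<longleftrightarrow> loc_bounded f"
| "sobolev (Suc k) f \<longleftrightarrow> (\<exists>g. sobolev k g \<and> primitive f g)"

lemma sobolev_const [simp]: "sobolev k (\<lambda>x. c)"
proof (induction k arbitrary: c)
  case (Suc k)
  then show ?case using primitive_const[of c] by auto
qed simp

lemma sobolev_SucD: "sobolev (Suc k) f \<Longrightarrow> sobolev k f"
  by (induction k arbitrary: f) (auto intro: primitive_imp_loc_bounded)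

lemma sobolev_mono: "sobolev k f \<Longrightarrow> j \<le> k \<Longrightarrow> sobolev j f"
  by (induction k) (auto simp del: sobolev.simps dest: sobolev_SucD elim: le_SucE)

lemma sobolev_loc_bounded: "sobolev k f \<Longrightarrow> loc_bounded f"
  using sobolev_mono[of k f 0] by simp

lemma sobolev_continuous: "sobolev k f \<Longrightarrow> k \<ge> 1 \<Longrightarrow> continuous_on UNIV f"
  using sobolev_mono[of k f "Suc 0"] primitive_continuous by auto

lemma sobolev_add: "sobolev k f \<Longrightarrow> sobolev k g \<Longrightarrow> sobolev k (\<lambda>x. f x + g x)"
proof (induction k arbitrary: f g)
  case (Suc k)
  then obtain f' g' where "sobolev k f'" "primitive f f'" "sobolev k g'" "primitive g g'" by auto
  then show ?case using Suc.IH[of f' g'] primitive_add[of f f' g g'] by auto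
qed (auto intro: loc_bounded_add)

lemma sobolev_mult: "sobolev k f \<Longrightarrow> sobolev k g \<Longrightarrow> sobolev k (\<lambda>x. f x * g x)"
proof (induction k arbitrary: f g)
  case (Suc k)
  then obtain f' g' where fg: "sobolev k f'" "primitive f f'" "sobolev k g'" "primitive g g'" by auto
  have "sobolev k (\<lambda>x. f' x * g x + f x * g' x)"
    using Suc.prems fg by (intro sobolev_add Suc.IH) (auto intro: sobolev_SucD simp del: sobolev.simps)
  then show ?case using primitive_mult[OF fg(2,4)] by auto
qed (auto intro: loc_bounded_mult)

lemma sobolev_uminus: "sobolev k f \<Longrightarrow> sobolev k (\<lambda>x. - f x)"
  using sobolev_mult[OF sobolev_const[of k "-1"], of f] by simp

lemma sobolev_diff: "sobolev k f \<Longrightarrow> sobolev k g \<Longrightarrow> sobolev k (\<lambda>x. f x - g x)"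
  using sobolev_add[OF _ sobolev_uminus, of k f g] by simp

lemma sobolev_power: "sobolev k f \<Longrightarrow> sobolev k (\<lambda>x. f x ^ n)"
  by (induction n) (auto intro: sobolev_mult)

lemma sobolev_sum:
  "(\<And>i. i \<in> I \<Longrightarrow> sobolev k (f i)) \<Longrightarrow> sobolev k (\<lambda>x. \<Sum>i\<in>I. f i x)"
  by (induction I rule: infinite_finite_induct) (auto intro: sobolev_add)

section \<open>Test functions and distributional derivatives\<close>

text \<open>For continuous weak derivatives the derivative is classical, hence unique. Therefore one and the
same \<open>g\<close> works at all orders.\<close>
lemma smooth_derivative:
  assumes "\<And>k. sobolev k f"
  obtains g where "\<And>k. sobolev k g" "primitive f g" "\<And>x. (f has_vector_derivative g x) (at x)"
proof -
  obtain g where g: "sobolev 1 g" "primitive f g"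
    using assms[of "Suc 1"] unfolding sobolev.simps(2)[of 1] by blast
  have der: "(f has_vector_derivative g x) (at x)" for x
    by (rule primitive_has_derivative[OF g(2) sobolev_continuous[OF g(1)]]) simp
  have "sobolev (Suc k) g" for k
  proof -
    obtain g' where g': "sobolev (Suc k) g'" "primitive f g'"
      using assms[of "Suc (Suc k)"] unfolding sobolev.simps(2)[of "Suc k"] by blast
    have "(f has_vector_derivative g' x) (at x)" for x
      by (rule primitive_has_derivative[OF g'(2) sobolev_continuous[OF g'(1)]]) simp
    then have "g' = g"
      using der vector_derivative_unique_at by blast
    then show ?thesis using g'(1) by simp
  qed
  then have "sobolev k g" for k using sobolev_SucD by blast
  then show ?thesis using that g(2) der by blast
qed

lemma smooth_imp_test_function:
  assumes "\<And>k. sobolev k f" "\<And>x. \<bar>x\<bar> > R \<Longrightarrow> f x = 0"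
  shows "f \<in> test_functions"
proof -
  let ?D = "\<lambda>f t. vector_derivative f (at t) :: complex"
  have "sobolev j ((?D ^^ k) f)" for j k
  proof (induction k arbitrary: j)
    case (Suc k)
    obtain g where g: "\<And>k. sobolev k g" "\<And>x. ((?D ^^ k) f has_vector_derivative g x) (at x)"
      using smooth_derivative[OF Suc] by metis
    then have "?D ((?D ^^ k) f) = g"
      by (auto simp: vector_derivative_at)
    then show ?case using g(1) by simp
  qed (use assms in simp)
  note S = this
  have "(?D ^^ k) f differentiable at x" for k x
    using smooth_derivative[OF S] differentiableI_vector by metis
  moreover have "bounded {x. f x \<noteq> 0}"
    using assms(2) unfolding bounded_iff by (intro exI[of _ R]) (auto, force)
  ultimately show ?thesis
    unfolding test_functions_def by (simp add: compact_closure)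
qed

lemma test_function_derivative:
  assumes "\<phi> \<in> test_functions"
  shows "(\<lambda>x. vector_derivative \<phi> (at x)) \<in> test_functions"
    and "primitive \<phi> (\<lambda>x. vector_derivative \<phi> (at x))"
proof -
  let ?D = "\<lambda>f t. vector_derivative f (at t) :: complex"
  have diff: "((?D ^^ k) \<phi>) differentiable (at x)" for k x
    using assms unfolding test_functions_def by blast
  have comp: "compact (closure {x. \<phi> x \<noteq> 0})"
    using assms unfolding test_functions_def by blast
  have 1: "?D \<phi> x = 0" if "x \<notin> closure {x. \<phi> x \<noteq> 0}" for x
  proof -
    have "((\<lambda>_. 0) has_vector_derivative 0) (at x)" by simp
    then have "(\<phi> has_vector_derivative 0) (at x)"
    proof (rule has_vector_derivative_transform_within_open[where S = "- closure {x. \<phi> x \<noteq> 0}"])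
      show "0 = \<phi> y" if "y \<in> - closure {x. \<phi> x \<noteq> 0}" for y
        using that closure_subset by force
    qed (use that in auto)
    then show ?thesis by (rule vector_derivative_at)
  qed
  have "closure {x. ?D \<phi> x \<noteq> 0} \<subseteq> closure {x. \<phi> x \<noteq> 0}"
    using 1 by (intro closure_minimal) auto
  then have "compact (closure {x. ?D \<phi> x \<noteq> 0})"
    using comp bounded_subset closed_closure unfolding compact_eq_bounded_closed by blast
  moreover have "((?D ^^ k) (?D \<phi>)) differentiable (at x)" for k x
    using diff[of "Suc k" x] by (simp only: funpow_Suc_right o_apply)
  ultimately show "?D \<phi> \<in> test_functions"
    unfolding test_functions_def by blast
  have "continuous_on UNIV (?D \<phi>)"
    using diff[of 1] by (auto simp: differentiable_imp_continuous_within continuous_on_eq_continuous_within)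
  moreover have "(\<phi> has_vector_derivative ?D \<phi> x) (at x)" for x
    using diff[of 0 x] by (simp add: vector_derivative_works)
  ultimately show "primitive \<phi> (?D \<phi>)"
    by (intro primitive_of_derivative continuous_imp_loc_bounded)
qed

lemma test_function_props:
  assumes "\<phi> \<in> test_functions"
  obtains R where "loc_bounded \<phi>" "\<And>x. \<bar>x\<bar> > R \<Longrightarrow> \<phi> x = 0"
proof -
  have "loc_bounded \<phi>"
    using test_function_derivative(2)[OF assms] by (rule primitive_imp_loc_bounded)
  moreover have "bounded {x. \<phi> x \<noteq> 0}"
    using assms compact_imp_bounded bounded_subset closure_subset unfolding test_functions_def by blast
  then obtain R where "\<forall>x\<in>{x. \<phi> x \<noteq> 0}. norm x \<le> R"
    unfolding bounded_iff by blast
  ultimately show ?thesis using that[of R] by force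
qed

text \<open>Integration by parts: the product with a test function is a primitive of the two terms and
vanishes at both ends of a large interval.\<close>
lemma primitive_dist_deriv:
  assumes u: "primitive u v"
  shows "dist_eq (dist_deriv (regular_dist u)) (regular_dist v)"
  unfolding dist_eq_def
proof
  fix \<phi> assume \<phi>: "\<phi> \<in> test_functions"
  define \<psi> where "\<psi> = (\<lambda>x. vector_derivative \<phi> (at x))"
  have p: "primitive \<phi> \<psi>" and "\<psi> \<in> test_functions"
    using test_function_derivative[OF \<phi>] unfolding \<psi>_def by auto
  obtain R1 where R1: "loc_bounded \<phi>" "\<And>x. \<bar>x\<bar> > R1 \<Longrightarrow> \<phi> x = 0"
    using test_function_props[OF \<phi>] by metis
  obtain R2 where R2: "loc_bounded \<psi>" "\<And>x. \<bar>x\<bar> > R2 \<Longrightarrow> \<psi> x = 0"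
    using test_function_props[OF \<open>\<psi> \<in> _\<close>] by metis
  define R where "R = \<bar>R1\<bar> + \<bar>R2\<bar> + 1"
  have Z: "\<phi> x = 0" "\<psi> x = 0" if "\<bar>x\<bar> > R - 1/2" for x
    using R1(2)[of x] R2(2)[of x] that by (auto simp: R_def)
  have v: "loc_bounded (\<lambda>x. v x * \<phi> x)" "loc_bounded (\<lambda>x. u x * \<psi> x)"
    using u R1 R2 primitive_imp_loc_bounded primitive_loc_bounded by (auto intro: loc_bounded_mult)
  have "((\<lambda>x. v x * \<phi> x + u x * \<psi> x) has_integral (u R * \<phi> R - u (-R) * \<phi> (-R))) {-R..R}"
    by (rule primitiveD[OF primitive_mult[OF u p]]) (simp add: R_def)
  then have "((\<lambda>x. v x * \<phi> x + u x * \<psi> x) has_integral 0) {-R..R}"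
    using Z[of R] Z[of "-R"] by (simp add: R_def)
  then have "integral {-R..R} (\<lambda>x. v x * \<phi> x) + integral {-R..R} (\<lambda>x. u x * \<psi> x) = 0"
    using integral_add[OF loc_bounded_integrable_on[OF v(1)] loc_bounded_integrable_on[OF v(2)]]
      integral_unique by metis
  then have "(LINT x|lebesgue. v x * \<phi> x) + (LINT x|lebesgue. u x * \<psi> x) = 0"
    using loc_bounded_integral_eq(2)[OF v(1), of R] loc_bounded_integral_eq(2)[OF v(2), of R] Z
    by auto
  then show "dist_deriv (regular_dist u) \<phi> = regular_dist v \<phi>"
    unfolding dist_deriv_def regular_dist_def \<psi>_def by (simp add: add_eq_0_iff)
qed

lemma dist_eq_trans [trans]: "dist_eq S T \<Longrightarrow> dist_eq T U \<Longrightarrow> dist_eq S U"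
  unfolding dist_eq_def by simp

lemma dist_eq_sym: "dist_eq S T \<Longrightarrow> dist_eq T S"
  unfolding dist_eq_def by simp

lemma dist_eq_deriv: "dist_eq S T \<Longrightarrow> dist_eq (dist_deriv S) (dist_deriv T)"
  unfolding dist_eq_def dist_deriv_def using test_function_derivative(1) by simp

definition loc_integrable :: "(real \<Rightarrow> complex) \<Rightarrow> bool" where
  "loc_integrable f \<longleftrightarrow> f \<in> borel_measurable lebesgue \<and> (\<forall>a b. f absolutely_integrable_on {a..b})"

lemma loc_bounded_imp_loc_integrable: "loc_bounded f \<Longrightarrow> loc_integrable f"
  unfolding loc_integrable_def using loc_bounded_absolutely_integrable by (auto simp: loc_bounded_def)

lemma loc_integrable_diff: "loc_integrable f \<Longrightarrow> loc_integrable g \<Longrightarrow> loc_integrable (\<lambda>x. f x - g x)"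
  unfolding loc_integrable_def by auto

lemma loc_integrable_AE_cong:
  assumes "loc_integrable f" "AE x in lebesgue. f x = g x" "g \<in> borel_measurable lebesgue"
  shows "loc_integrable g"
  unfolding loc_integrable_def
proof (intro conjI allI assms(3))
  fix a b :: real
  have "set_integrable lebesgue {a..b} f" using assms(1) unfolding loc_integrable_def by blast
  then show "set_integrable lebesgue {a..b} g"
    by (rule set_integrable_cong_AE[THEN iffD1, rotated -1])
      (use assms in \<open>auto simp: loc_integrable_def\<close>)
qed

lemma integrable_loc_integrable_mult:
  assumes f: "loc_integrable f" and g: "loc_bounded g" "\<And>x. \<bar>x\<bar> > R \<Longrightarrow> g x = 0"
  shows "integrable lebesgue (\<lambda>x. f x * g x)"
proof -
  obtain B where B: "B > 0" "\<And>x. \<bar>x\<bar> \<le> R \<Longrightarrow> norm (g x) \<le> B"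
    using loc_bounded_bound[OF g(1)] by metis
  have "set_integrable lebesgue {-R..R} f"
    using f unfolding loc_integrable_def by blast
  then have "integrable lebesgue (\<lambda>x. B *\<^sub>R (indicator {-R..R} x *\<^sub>R f x))"
    unfolding set_integrable_def by (rule integrable_scaleR_right)
  then show ?thesis
  proof (rule Bochner_Integration.integrable_bound)
    show "(\<lambda>x. f x * g x) \<in> borel_measurable lebesgue"
      using f g(1) unfolding loc_integrable_def loc_bounded_def by auto
    show "AE x in lebesgue. norm (f x * g x) \<le> norm (B *\<^sub>R (indicator {-R..R} x *\<^sub>R f x))"
    proof (rule AE_I2)
      fix x
      have "norm (f x) * norm (g x) \<le> norm (f x) * B" if "\<bar>x\<bar> \<le> R"
        using B that by (intro mult_left_mono) auto
      then show "norm (f x * g x) \<le> norm (B *\<^sub>R (indicator {-R..R} x *\<^sub>R f x))"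
        using B(1) g(2)[of x] by (cases "\<bar>x\<bar> \<le> R") (auto simp: indicator_def norm_mult mult.commute abs_le_iff)
    qed
  qed
qed

section \<open>Flat functions and bumps\<close>

lemma poly_times_exp_neg_tendsto_0:
  "((\<lambda>y::real. y ^ k * poly P y * exp (- y)) \<longlongrightarrow> 0) at_top"
proof (induction P arbitrary: k)
  case (pCons a P)
  have "((\<lambda>y. a * (y ^ k / exp y) + y ^ Suc k * poly P y * exp (- y)) \<longlongrightarrow> a * 0 + 0) at_top"
    by (intro tendsto_add tendsto_mult tendsto_const tendsto_power_div_exp_0 pCons)
  then show ?case by (simp add: algebra_simps exp_minus field_simps)
qed simp

text \<open>The functions \<open>t \<mapsto> P(1/t) exp(-1/t)\<close> for positive \<open>t = s (x - a)\<close>, extended by zero. With an arbitrary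
polynomial \<open>P\<close> the family is closed under differentiation, which gives smoothness by induction. The
scale \<open>s\<close> selects the side of \<open>a\<close> by its sign and the steepness by its size.\<close>
definition flat :: "real poly \<Rightarrow> real \<Rightarrow> real \<Rightarrow> real \<Rightarrow> complex" where
  "flat P s a x =
     (if s * (x - a) \<le> 0 then 0
      else of_real (poly P (1 / (s * (x - a))) * exp (- (1 / (s * (x - a))))))"

lemma flat_has_derivative:
  assumes "s \<noteq> 0"
  shows "(flat P s a has_vector_derivative
           of_real s * flat ([:0, 0, 1:] * (P - pderiv P)) s a x) (at x)"
proof -
  consider "s * (x - a) < 0" | "s * (x - a) > 0" | "x = a" using assms by fastforce
  then show ?thesis
  proof cases
    case 1
    have "((\<lambda>_. 0) has_vector_derivative of_real s * flat ([:0, 0, 1:] * (P - pderiv P)) s a x) (at x)"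
      using 1 by (simp add: flat_def)
    then show ?thesis
      by (rule has_vector_derivative_transform_within_open[where S = "{x. s * (x - a) < 0}"])
        (use 1 in \<open>auto simp: flat_def intro!: open_Collect_less continuous_intros\<close>)
  next
    case 2
    have "((\<lambda>x. poly P (1 / (s * (x - a))) * exp (- (1 / (s * (x - a)))))
        has_real_derivative s * (poly ([:0, 0, 1:] * (P - pderiv P)) (1 / (s * (x - a)))
          * exp (- (1 / (s * (x - a)))))) (at x)"
    proof -
      define T where "T = (\<lambda>x. 1 / (s * (x - a)))"
      have "(T has_real_derivative - s * (T x)\<^sup>2) (at x)"
        unfolding T_def using 2 by (auto intro!: derivative_eq_intros simp: field_simps power2_eq_square)
      moreover have "((\<lambda>y. poly P y * exp (- y)) has_real_derivative
          poly (pderiv P) (T x) * exp (- T x) - poly P (T x) * exp (- T x)) (at (T x))"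
        by (auto intro!: derivative_eq_intros poly_DERIV)
      ultimately have "((\<lambda>x. poly P (T x) * exp (- T x)) has_real_derivative
          (poly (pderiv P) (T x) * exp (- T x) - poly P (T x) * exp (- T x)) * (- s * (T x)\<^sup>2)) (at x)"
        by (rule DERIV_chain2[rotated])
      then show ?thesis
        unfolding T_def[symmetric] fun_cong[OF T_def, symmetric]
        by (rule DERIV_cong) (simp add: algebra_simps power2_eq_square)
    qed
    then have "((\<lambda>x. of_real (poly P (1 / (s * (x - a))) * exp (- (1 / (s * (x - a))))))
        has_vector_derivative (of_real (s * (poly ([:0, 0, 1:] * (P - pderiv P)) (1 / (s * (x - a)))
          * exp (- (1 / (s * (x - a)))))) :: complex)) (at x)"
      by (rule has_vector_derivative_of_real)
    then show ?thesis
      by (rule has_vector_derivative_transform_within_open[where S = "{x. 0 < s * (x - a)}",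
            THEN has_vector_derivative_eq_rhs])
        (use 2 in \<open>auto simp: flat_def intro!: open_Collect_less continuous_intros\<close>)
  next
    case 3
    let ?r = "\<lambda>y. \<bar>s\<bar> * \<bar>y * poly P y * exp (- y)\<bar>"
    have lim: "((\<lambda>y. ?r y) \<longlongrightarrow> 0) at_top"
      using poly_times_exp_neg_tendsto_0[of 1 P]
      by (intro tendsto_mult_right_zero tendsto_rabs_zero) simp
    have "((\<lambda>y. norm (flat P s a y / of_real (y - a))) \<longlongrightarrow> 0) (at a)"
      unfolding tendsto_iff
    proof (intro allI impI)
      fix e :: real assume "e > 0"
      then have "eventually (\<lambda>y. ?r y < e) at_top"
        using tendstoD[OF lim] by (auto simp: dist_real_def abs_mult)
      then obtain M where M: "\<And>y. y \<ge> M \<Longrightarrow> ?r y < e"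
        unfolding eventually_at_top_linorder by blast
      define d where "d = 1 / (\<bar>s\<bar> * (\<bar>M\<bar> + 1))"
      have "d > 0" using assms by (simp add: d_def)
      moreover have "dist (norm (flat P s a y / of_real (y - a))) 0 < e"
        if y: "y \<noteq> a" "dist y a < d" for y
      proof (cases "s * (y - a) \<le> 0")
        case True
        then show ?thesis using \<open>e > 0\<close> by (simp add: flat_def)
      next
        case False
        \<comment> \<open>in the variable \<open>w\<close> the difference quotient at \<open>a\<close> is \<open>s w P(w) exp(-w)\<close>\<close>
        define w where "w = 1 / (s * (y - a))"
        have w: "w > 0" "s * (y - a) = 1 / w" using False by (auto simp: w_def)
        have "\<bar>s * (y - a)\<bar> < 1 / (\<bar>M\<bar> + 1)"
        proof -
        have "\<bar>s\<bar> * \<bar>y - a\<bar> < \<bar>s\<bar> * d"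
          using y assms by (intro mult_strict_left_mono) (auto simp: dist_real_def)
        also have "\<dots> = 1 / (\<bar>M\<bar> + 1)" using assms by (simp add: d_def)
        finally show ?thesis by (simp add: abs_mult)
      qed
        then have "w \<ge> \<bar>M\<bar> + 1"
          using w by (simp add: field_simps)
        then have "?r w < e" by (intro M) auto
        moreover have "norm (flat P s a y / of_real (y - a)) = ?r w"
        proof -
          have "1 / (y - a) = s * w" using w y assms by (simp add: field_simps)
          then have "norm (1 / (of_real (y - a) :: complex)) = \<bar>s\<bar> * \<bar>w\<bar>"
            by (metis abs_mult norm_of_real of_real_1 of_real_divide)
          moreover have "norm (flat P s a y) = \<bar>poly P w * exp (- w)\<bar>"
            using False unfolding flat_def w_def by (simp only: if_False norm_of_real)
          moreover have "norm (flat P s a y / of_real (y - a))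
              = norm (flat P s a y) * norm (1 / (of_real (y - a) :: complex))"
            by (simp add: norm_divide)
          ultimately show ?thesis by (simp add: abs_mult)
        qed
        ultimately show ?thesis by simp
      qed
      ultimately show "\<forall>\<^sub>F y in at a. dist (norm (flat P s a y / of_real (y - a))) 0 < e"
        unfolding eventually_at by blast
    qed
    then have "((\<lambda>y. norm (flat P s a y - flat P s a a - (y - a) *\<^sub>R 0) / norm (y - a)) \<longlongrightarrow> 0) (at a)"
      by (simp add: flat_def norm_divide flip: of_real_diff)
    then have "(flat P s a has_vector_derivative 0) (at a)"
      unfolding has_vector_derivative_def has_derivative_iff_norm
      by (simp add: bounded_linear_scaleR_left)
    then show ?thesis using 3 by (simp add: flat_def)
  qed
qed

lemma sobolev_flat: "s \<noteq> 0 \<Longrightarrow> sobolev k (flat P s a)"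
proof (induction k arbitrary: P)
  have lb: "loc_bounded (flat P s a)" if "s \<noteq> 0" for P
    using flat_has_derivative[OF that] has_vector_derivative_continuous
    by (intro continuous_imp_loc_bounded) (auto simp: continuous_on_eq_continuous_at, blast)
  case 0
  then show ?case using lb by simp
  case (Suc k)
  have "sobolev k (\<lambda>x. of_real s * flat ([:0, 0, 1:] * (P - pderiv P)) s a x)"
    by (intro sobolev_mult sobolev_const Suc)
  moreover have "primitive (flat P s a) (\<lambda>x. of_real s * flat ([:0, 0, 1:] * (P - pderiv P)) s a x)"
    using Suc.prems by (intro primitive_of_derivative flat_has_derivative loc_bounded_mult lb) auto
  ultimately show ?case by auto
qed

definition bump :: "real \<Rightarrow> real \<Rightarrow> real \<Rightarrow> real \<Rightarrow> complex" where
  "bump s a b x = flat 1 s a x * flat 1 (- s) b x"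

lemma sobolev_bump: "s \<noteq> 0 \<Longrightarrow> sobolev k (bump s a b)"
  unfolding bump_def by (intro sobolev_mult sobolev_flat) auto

lemma bump_eq:
  assumes "s > 0"
  shows "bump s a b x = (if a < x \<and> x < b
    then of_real (exp (- (1 / (s * (x - a)))) * exp (- (1 / (s * (b - x))))) else 0)"
  using assms by (auto simp: bump_def flat_def zero_less_mult_iff mult_le_0_iff not_le algebra_simps)

lemma bump_test_function: "s > 0 \<Longrightarrow> bump s a b \<in> test_functions"
  by (rule smooth_imp_test_function[where R = "\<bar>a\<bar> + \<bar>b\<bar>"])
    (auto simp: sobolev_bump bump_eq)

lemma norm_bump_le: "s > 0 \<Longrightarrow> norm (bump s a b x) \<le> indicator {a..b} x"
  by (auto simp: bump_eq norm_mult indicator_def intro!: mult_le_one)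

text \<open>Letting the steepness grow turns the bumps into indicators of intervals, with domination by
\<open>norm_bump_le\<close>.\<close>
lemma bump_tendsto_indicator:
  "(\<lambda>n. bump (real (Suc n)) a b x) \<longlonglongrightarrow> (if a < x \<and> x < b then 1 else 0)"
proof (cases "a < x \<and> x < b")
  case True
  have *: "(\<lambda>n. 1 / (real (Suc n) * c)) \<longlonglongrightarrow> 0" for c :: real
  proof -
    have "(\<lambda>n. inverse (real (Suc n)) * inverse c) \<longlonglongrightarrow> 0 * inverse c"
      by (intro tendsto_mult LIMSEQ_inverse_real_of_nat tendsto_const)
    then show ?thesis by (simp add: field_simps)
  qed
  have "(\<lambda>n. of_real (exp (- (1 / (real (Suc n) * (x - a)))) * exp (- (1 / (real (Suc n) * (b - x)))))
      :: complex) \<longlonglongrightarrow> of_real (exp (- 0) * exp (- 0))"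
    by (intro tendsto_of_real tendsto_mult tendsto_exp tendsto_minus *)
  then show ?thesis using True by (simp add: bump_eq)
next
  case False
  then have "bump (real (Suc n)) a b x = 0" for n by (subst bump_eq) auto
  then show ?thesis using False by auto
qed

section \<open>The fundamental lemma and the du Bois-Reymond lemma\<close>

lemma interval_integral_zero_of_test:
  assumes f: "loc_integrable f" and z: "\<And>\<phi>. \<phi> \<in> test_functions \<Longrightarrow> (LINT x|lebesgue. f x * \<phi> x) = 0"
  shows "integral {a..b} f = 0"
proof -
  have fm: "f \<in> borel_measurable lebesgue" and ai: "set_integrable lebesgue {a..b} f"
    using f unfolding loc_integrable_def by auto
  have "(\<lambda>n. LINT x|lebesgue. f x * bump (real (Suc n)) a b x) \<longlonglongrightarrow>
      (LINT x|lebesgue. indicator {a..b} x *\<^sub>R f x)"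
  proof (rule integral_dominated_convergence[where w = "\<lambda>x. norm (indicator {a..b} x *\<^sub>R f x)"])
    show "(\<lambda>x. indicator {a..b} x *\<^sub>R f x) \<in> borel_measurable lebesgue"
      using ai unfolding set_integrable_def by auto
    show "integrable lebesgue (\<lambda>x. norm (indicator {a..b} x *\<^sub>R f x))"
      using ai unfolding set_integrable_def by (rule integrable_norm)
    show "(\<lambda>x. f x * bump (real (Suc i)) a b x) \<in> borel_measurable lebesgue" for i
      using fm sobolev_loc_bounded[OF sobolev_bump[of "real (Suc i)" 0 a b]]
      by (auto simp: loc_bounded_def)
    show "AE x in lebesgue. norm (f x * bump (real (Suc i)) a b x) \<le> norm (indicator {a..b} x *\<^sub>R f x)" for i
      using norm_bump_le[of "real (Suc i)" a b]
      by (intro AE_I2) (auto simp: norm_mult mult.commute[of _ "norm (f _)"] simp del: of_nat_Suc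
          intro!: mult_left_mono)
    have "negligible {a, b}" by simp
    then have "AE x in lebesgue. x \<notin> {a, b}"
      by (intro AE_not_in) (simp only: negligible_iff_null_sets)
    then show "AE x in lebesgue. (\<lambda>i. f x * bump (real (Suc i)) a b x) \<longlonglongrightarrow> indicator {a..b} x *\<^sub>R f x"
    proof eventually_elim
      case (elim x)
      have "(\<lambda>i. f x * bump (real (Suc i)) a b x) \<longlonglongrightarrow> f x * (if a < x \<and> x < b then 1 else 0)"
        by (intro tendsto_mult tendsto_const bump_tendsto_indicator)
      also have "f x * (if a < x \<and> x < b then 1 else 0) = indicator {a..b} x *\<^sub>R f x"
        using elim by (auto simp: indicator_def)
      finally show ?case .
    qed
  qed
  moreover have "(LINT x|lebesgue. f x * bump (real (Suc n)) a b x) = 0" for n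
    by (intro z bump_test_function) simp
  ultimately have "(LINT x|lebesgue. indicator {a..b} x *\<^sub>R f x) = 0"
    by (simp only: LIMSEQ_const_iff)
  then show ?thesis
    using set_lebesgue_integral_eq_integral(2)[OF ai] unfolding set_lebesgue_integral_def by simp
qed

text \<open>By Henstock's lemma the Riemann sums of \<open>\<parallel>f\<parallel>\<close> over fine divisions are close to the sum of the norms
of the interval integrals of \<open>f\<close>, and all of these vanish.\<close>
lemma norm_integral_zero_of_interval_integrals:
  fixes f :: "real \<Rightarrow> complex"
  assumes f: "f integrable_on {a..b}" and z: "\<And>u v. integral {u..v} f = 0"
  shows "((\<lambda>x. norm (f x)) has_integral 0) {a..b}"
  unfolding has_integral_real
proof (intro allI impI)
  fix e :: real assume "e > 0"
  have "f integrable_on cbox a b" using f by simp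
  then obtain \<gamma> where \<gamma>: "gauge \<gamma>"
    "\<And>p. \<lbrakk>p tagged_partial_division_of (cbox a b); \<gamma> fine p\<rbrakk> \<Longrightarrow>
       (\<Sum>(x,k)\<in>p. norm (Henstock_Kurzweil_Integration.content k *\<^sub>R f x - integral k f)) < e"
    by (rule Henstock_lemma[OF _ \<open>e > 0\<close>]) blast
  show "\<exists>\<gamma>. gauge \<gamma> \<and> (\<forall>\<D>. \<D> tagged_division_of {a..b} \<and> \<gamma> fine \<D> \<longrightarrow>
      norm ((\<Sum>(x,k)\<in>\<D>. Henstock_Kurzweil_Integration.content k *\<^sub>R norm (f x)) - 0) < e)"
  proof (intro exI[of _ \<gamma>] conjI allI impI \<gamma>(1))
    fix p assume p: "p tagged_division_of {a..b} \<and> \<gamma> fine p"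
    then have p': "p tagged_partial_division_of (cbox a b)"
      by (simp add: tagged_division_of_def)
    have "(\<Sum>(x,k)\<in>p. Henstock_Kurzweil_Integration.content k *\<^sub>R norm (f x)) = (\<Sum>(x,k)\<in>p. norm (Henstock_Kurzweil_Integration.content k *\<^sub>R f x - integral k f))"
    proof (rule sum.cong, simp, clarify)
      fix x k assume "(x, k) \<in> p"
      then obtain u v where "k = cbox u v"
        using tagged_partial_division_ofD(4)[OF p'] by blast
      then show "Henstock_Kurzweil_Integration.content k *\<^sub>R norm (f x) = norm (Henstock_Kurzweil_Integration.content k *\<^sub>R f x - integral k f)"
        using z by simp
    qed
    moreover have "\<dots> \<ge> 0" by (intro sum_nonneg) auto
    ultimately show "norm ((\<Sum>(x,k)\<in>p. Henstock_Kurzweil_Integration.content k *\<^sub>R norm (f x)) - 0) < e"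
      using \<gamma>(2)[OF p'] p by simp
  qed
qed

lemma fundamental_lemma:
  assumes f: "loc_integrable f" and z: "\<And>\<phi>. \<phi> \<in> test_functions \<Longrightarrow> (LINT x|lebesgue. f x * \<phi> x) = 0"
  shows "AE x in lebesgue. f x = 0"
proof -
  have "AE x in lebesgue. x \<in> {-real n..real n} \<longrightarrow> f x = 0" for n
  proof -
    have ai: "f absolutely_integrable_on {-real n..real n}"
      using f unfolding loc_integrable_def by blast
    have hi: "((\<lambda>x. norm (f x)) has_integral 0) {-real n..real n}"
      using ai interval_integral_zero_of_test[OF f z]
      by (intro norm_integral_zero_of_interval_integrals) (auto simp: absolutely_integrable_on_def)
    have ai': "set_integrable lebesgue {-real n..real n} (\<lambda>x. norm (f x))"
      using ai by (rule set_integrable_norm)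
    then have "(LINT x|lebesgue. indicator {-real n..real n} x *\<^sub>R norm (f x)) = 0"
      using set_lebesgue_integral_eq_integral(2)[OF ai'] integral_unique[OF hi]
      unfolding set_lebesgue_integral_def by simp
    then have "AE x in lebesgue. indicator {-real n..real n} x *\<^sub>R norm (f x) = 0"
      using ai' unfolding set_integrable_def by (subst (asm) integral_nonneg_eq_0_iff_AE) auto
    then show ?thesis by eventually_elim (auto simp: indicator_def)
  qed
  then have "AE x in lebesgue. \<forall>n. x \<in> {-real n..real n} \<longrightarrow> f x = 0"
    unfolding AE_all_countable by blast
  then show ?thesis
  proof eventually_elim
    case (elim x)
    obtain n where "\<bar>x\<bar> \<le> real n" using real_arch_simple by blast
    then show ?case using elim by (auto dest!: spec[of _ n])
  qed
qed

lemma regular_dist_inj: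
  assumes "loc_integrable f" "loc_integrable g" "dist_eq (regular_dist f) (regular_dist g)"
  shows "AE x in lebesgue. f x = g x"
proof -
  have "AE x in lebesgue. f x - g x = 0"
  proof (rule fundamental_lemma[OF loc_integrable_diff[OF assms(1,2)]])
    fix \<phi> assume \<phi>: "\<phi> \<in> test_functions"
    obtain R where R: "loc_bounded \<phi>" "\<And>x. \<bar>x\<bar> > R \<Longrightarrow> \<phi> x = 0"
      using test_function_props[OF \<phi>] by metis
    show "(LINT x|lebesgue. (f x - g x) * \<phi> x) = 0"
      using integrable_loc_integrable_mult[OF assms(1) R] integrable_loc_integrable_mult[OF assms(2) R]
        assms(3) \<phi> unfolding dist_eq_def regular_dist_def by (simp add: left_diff_distrib)
  qed
  then show ?thesis by eventually_elim simp
qed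

text \<open>If \<open>\<rho>\<close> is a test function of integral 1, then every test function \<open>\<psi>\<close> minus its integral times \<open>\<rho>\<close> has
integral zero and so is the derivative of a test function. Testing \<open>f\<close> with it shows that \<open>f\<close>
minus the constant \<open>\<integral>f \<rho>\<close> annihilates every \<open>\<psi>\<close>.\<close>
lemma du_Bois_Reymond:
  assumes f: "loc_integrable f"
    and z: "\<And>\<phi>. \<phi> \<in> test_functions \<Longrightarrow> (LINT x|lebesgue. f x * vector_derivative \<phi> (at x)) = 0"
  shows "\<exists>c. AE x in lebesgue. f x = c"
proof -
  \<comment> \<open>the integral of a bump, nonzero because the bump is positive on an interval\<close>
  define c0 where "c0 = (LINT x|lebesgue. bump 1 0 1 x)"
  have bsm: "sobolev k (bump 1 0 1)" for k by (rule sobolev_bump) simp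
  have bz: "bump 1 0 1 x = 0" if "\<bar>x\<bar> > 1" for x using that by (auto simp: bump_eq)
  have "c0 \<noteq> 0"
  proof
    let ?g = "\<lambda>x. if 0 < x \<and> x < 1 then exp (- (1 / x)) * exp (- (1 / (1 - x))) else 0 :: real"
    assume "c0 = 0"
    have int: "integrable lebesgue (bump 1 0 1)"
      by (rule loc_bounded_integral_eq(1)[OF sobolev_loc_bounded[OF bsm] bz])
    have b: "bump 1 0 1 = (\<lambda>x. of_real (?g x))" by (auto simp: bump_eq fun_eq_iff)
    have int': "integrable lebesgue ?g" using integrable_Re[OF int[unfolded b]] by simp
    have "(LINT x|lebesgue. ?g x) = 0" using \<open>c0 = 0\<close> unfolding c0_def b by simp
    then have "AE x in lebesgue. ?g x = 0"
      using integral_nonneg_eq_0_iff_AE[OF int'] by simp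
    then have "AE x in lebesgue. x \<notin> {0<..<1::real}" by eventually_elim auto
    then have "{0<..<1::real} \<in> null_sets lebesgue"
      by (subst AE_iff_null_sets) auto
    then show False
      using open_not_negligible[of "{0<..<1::real}"] negligible_iff_null_sets by auto
  qed
  define \<rho> where "\<rho> = (\<lambda>x. bump 1 0 1 x / c0)"
  have \<rho>: "sobolev k \<rho>" for k
    using sobolev_mult[OF sobolev_const[of k "inverse c0"] bsm[of k]]
    by (simp add: \<rho>_def divide_inverse mult.commute)
  have \<rho>z: "\<rho> x = 0" if "\<bar>x\<bar> > 1" for x using bz[OF that] by (simp add: \<rho>_def)
  have \<rho>1: "(LINT x|lebesgue. \<rho> x) = 1"
    using \<open>c0 \<noteq> 0\<close> unfolding \<rho>_def c0_def by simp
  define C where "C = (LINT x|lebesgue. f x * \<rho> x)"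
  have "AE x in lebesgue. f x - C = 0"
  proof (rule fundamental_lemma)
    show "loc_integrable (\<lambda>x. f x - C)"
      by (intro loc_integrable_diff f loc_bounded_imp_loc_integrable loc_bounded_const)
    fix \<psi> assume \<psi>: "\<psi> \<in> test_functions"
    have \<psi>s: "sobolev k \<psi>" for k
      using \<psi>
    proof (induction k arbitrary: \<psi>)
      case 0
      then show ?case using test_function_props by (metis sobolev.simps(1))
    next
      case (Suc k)
      then show ?case using test_function_derivative by auto
    qed
    obtain R1 where R1: "loc_bounded \<psi>" "\<And>x. \<bar>x\<bar> > R1 \<Longrightarrow> \<psi> x = 0"
      using test_function_props[OF \<psi>] by metis
    define R where "R = \<bar>R1\<bar> + 1"
    have Z: "\<psi> x = 0" "\<rho> x = 0" if "\<bar>x\<bar> > R" for x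
      using R1(2)[of x] \<rho>z[of x] that by (auto simp: R_def)
    define I where "I = (LINT x|lebesgue. \<psi> x)"
    define g where "g = (\<lambda>x. \<psi> x - I * \<rho> x)"
    note lbs = R1(1) sobolev_loc_bounded[OF \<rho>]
    have gs: "sobolev k g" for k
      unfolding g_def by (intro sobolev_diff sobolev_mult sobolev_const \<psi>s \<rho>)
    have gZ: "g x = 0" if "\<bar>x\<bar> > R" for x using Z[OF that] by (simp add: g_def)
    have ints: "integrable lebesgue \<psi>" "integrable lebesgue \<rho>"
      using loc_bounded_integral_eq(1)[OF R1(1), of R] Z
        loc_bounded_integral_eq(1)[OF sobolev_loc_bounded[OF \<rho>], of R] by auto
    have "integral {-R..R} g = (LINT x|lebesgue. g x)"
      using loc_bounded_integral_eq(2)[OF sobolev_loc_bounded[OF gs] gZ] by simp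
    also have "\<dots> = I - I * 1" unfolding g_def using ints \<rho>1 by (simp add: I_def)
    finally have g0: "integral {-R..R} g = 0" by simp
    \<comment> \<open>as \<open>g\<close> has integral zero, its primitive vanishes to the right of its support as well\<close>
    obtain \<phi> where \<phi>: "primitive \<phi> g" "\<phi> (-R) = 0"
      using primitive_integral[OF sobolev_loc_bounded[OF gs]] by metis
    have gi: "integral {x..y} g = \<phi> y - \<phi> x" if "x \<le> y" for x y
      using primitiveD[OF \<phi>(1) that] by (rule integral_unique)
    have "\<phi> x = 0" if "\<bar>x\<bar> > R" for x
    proof -
      have z: "integral {u..v} g = 0" if "R \<le> u \<or> v \<le> -R" for u v
      proof -
        have "integral {u..v} g = integral {u..v} (\<lambda>_. 0)"
          by (rule integral_spike[of "{-R,R}"]) (use that gZ in \<open>auto\<close>)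
        then show ?thesis by simp
      qed
      have "\<phi> R = 0" using gi[of "-R" R] g0 \<phi>(2) by (simp add: R_def)
      then show ?thesis
        using z[of x "-R"] z[of R x] gi[of x "-R"] gi[of R x] \<phi>(2) that by (cases "x < 0") auto
    qed
    moreover have "sobolev k \<phi>" for k
      using sobolev_SucD[of k \<phi>] gs \<phi>(1) by auto
    ultimately have "\<phi> \<in> test_functions"
      by (intro smooth_imp_test_function) auto
    moreover have "vector_derivative \<phi> (at x) = g x" for x
      by (intro vector_derivative_at primitive_has_derivative[OF \<phi>(1)] sobolev_continuous[OF gs[of 1]]) simp
    ultimately have "(LINT x|lebesgue. f x * g x) = 0"
      using z[of \<phi>] by simp
    moreover have if1: "integrable lebesgue (\<lambda>x. f x * \<psi> x)" "integrable lebesgue (\<lambda>x. f x * \<rho> x)"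
      using integrable_loc_integrable_mult[OF f R1(1), of R] Z
        integrable_loc_integrable_mult[OF f sobolev_loc_bounded[OF \<rho>], of R] by auto
    moreover have "(\<lambda>x. f x * g x) = (\<lambda>x. f x * \<psi> x - I * (f x * \<rho> x))"
      by (auto simp: g_def algebra_simps)
    ultimately have "(LINT x|lebesgue. f x * \<psi> x) - I * C = 0"
      using if1 by (simp add: C_def)
    moreover have "(\<lambda>x. (f x - C) * \<psi> x) = (\<lambda>x. f x * \<psi> x - C * \<psi> x)"
      by (auto simp: algebra_simps)
    ultimately show "(LINT x|lebesgue. (f x - C) * \<psi> x) = 0"
      using if1 ints by (simp add: I_def mult.commute)
  qed
  then have "AE x in lebesgue. f x = C" by eventually_elim simp
  then show ?thesis by blast
qed

section \<open>Regularity of functions with locally bounded weak derivatives\<close>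

lemma Linf_loc_representative:
  assumes "v \<in> Linf_loc"
  obtains w where "loc_bounded w" "AE x in lebesgue. w x = v x"
proof -
  have vm: "v \<in> borel_measurable lebesgue" using assms by (simp add: Linf_loc_def)
  have "\<forall>n::nat. \<exists>B. AE x in lebesgue. x \<in> {-real n..real n} \<longrightarrow> norm (v x) \<le> B"
    using assms compact_Icc unfolding Linf_loc_def by blast
  then obtain B where B: "\<And>n::nat. AE x in lebesgue. x \<in> {-real n..real n} \<longrightarrow> norm (v x) \<le> B n"
    by metis
  \<comment> \<open>discarding the points where one of the countably many bounds fails changes \<open>v\<close> on a null set only\<close>
  define P where "P x \<longleftrightarrow> (\<forall>n::nat. x \<in> {-real n..real n} \<longrightarrow> norm (v x) \<le> B n)" for x
  define w where "w x = (if P x then v x else 0)" for x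
  have "AE x in lebesgue. P x"
    unfolding P_def AE_all_countable using B by blast
  then have "AE x in lebesgue. w x = v x"
    by eventually_elim (simp add: w_def)
  moreover have "loc_bounded w"
    unfolding loc_bounded_def
  proof (intro conjI allI)
    have [measurable]: "v \<in> borel_measurable lebesgue" "(\<lambda>x::real. x) \<in> borel_measurable lebesgue"
      by (auto intro: vm measurable_completion)
    have "Measurable.pred lebesgue P"
      unfolding P_def by measurable
    then show "w \<in> borel_measurable lebesgue"
      unfolding w_def using vm by measurable
    fix R
    obtain n where n: "R \<le> real n" using real_arch_simple by blast
    show "\<exists>B. \<forall>x. \<bar>x\<bar> \<le> R \<longrightarrow> norm (w x) \<le> B"
      using n by (intro exI[of _ "\<bar>B n\<bar>"]) (auto simp: w_def P_def dest!: spec[of _ n])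
  qed
  ultimately show ?thesis using that by blast
qed

lemma Linf_loc_loc_integrable:
  assumes "v \<in> Linf_loc"
  shows "loc_integrable v"
proof -
  obtain w where "loc_bounded w" "AE x in lebesgue. w x = v x"
    using Linf_loc_representative[OF assms] .
  then show ?thesis
    using assms by (intro loc_integrable_AE_cong[OF loc_bounded_imp_loc_integrable])
      (auto simp: Linf_loc_def)
qed

lemma L2_loc_integrable:
  assumes "f \<in> L2"
  shows "loc_integrable f"
  unfolding loc_integrable_def
proof (intro conjI allI)
  show fm: "f \<in> borel_measurable lebesgue" using assms by (simp add: L2_def)
  fix a b :: real
  have "integrable lebesgue (\<lambda>x. (norm (f x))\<^sup>2 + indicator {a..b} x)"
    using assms by (intro Bochner_Integration.integrable_add)
      (auto simp: L2_def simp flip: lmeasurable_iff_integrable)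
  then have "integrable lebesgue (\<lambda>x. indicator {a..b} x *\<^sub>R f x)"
  proof (rule Bochner_Integration.integrable_bound)
    show "(\<lambda>x. indicator {a..b} x *\<^sub>R f x) \<in> borel_measurable lebesgue"
      using fm by (intro borel_measurable_scaleR borel_measurable_indicator) auto
    have "t \<le> \<bar>t\<^sup>2 + 1\<bar>" for t :: real
      using zero_le_power2[of "t - 1"] zero_le_power2[of t] zero_le_power2[of "t + 1"]
      by (simp add: power2_eq_square algebra_simps)
    then show "AE x in lebesgue. norm (indicator {a..b} x *\<^sub>R f x) \<le> norm ((norm (f x))\<^sup>2 + indicator {a..b} x)"
      by (auto simp: indicator_def)
  qed
  then show "f absolutely_integrable_on {a..b}" by (simp add: set_integrable_def)
qed

lemma continuous_AE_eq:
  fixes f g :: "real \<Rightarrow> complex"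
  assumes "continuous_on UNIV f" "continuous_on UNIV g" "AE x in lebesgue. f x = g x"
  shows "f = g"
proof -
  have "open {x. f x \<noteq> g x}"
    using assms(1,2) by (intro open_Collect_neq)
  moreover have "{x. f x \<noteq> g x} \<in> null_sets lebesgue"
    using assms(3) \<open>open _\<close> by (subst AE_iff_null_sets) auto
  ultimately have "{x. f x \<noteq> g x} = {}"
    using open_not_negligible negligible_iff_null_sets by blast
  then show ?thesis by auto
qed

lemma weak_derivative_imp_primitive:
  assumes f: "loc_integrable f" and v: "loc_bounded v"
    and d: "dist_eq (dist_deriv (regular_dist f)) (regular_dist v)"
  obtains w where "primitive w v" "AE x in lebesgue. w x = f x"
proof -
  obtain V where V: "primitive V v" using primitive_integral[OF v] by metis
  have Vi: "loc_integrable V"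
    by (intro loc_bounded_imp_loc_integrable primitive_imp_loc_bounded[OF V])
  have "\<exists>c. AE x in lebesgue. f x - V x = c"
  proof (rule du_Bois_Reymond[OF loc_integrable_diff[OF f Vi]])
    fix \<phi> assume \<phi>: "\<phi> \<in> test_functions"
    let ?\<psi> = "\<lambda>x. vector_derivative \<phi> (at x)"
    obtain R where R: "loc_bounded ?\<psi>" "\<And>x. \<bar>x\<bar> > R \<Longrightarrow> ?\<psi> x = 0"
      using test_function_props[OF test_function_derivative(1)[OF \<phi>]] by metis
    have "dist_eq (dist_deriv (regular_dist f)) (dist_deriv (regular_dist V))"
      using dist_eq_trans[OF d dist_eq_sym[OF primitive_dist_deriv[OF V]]] .
    then have "(LINT x|lebesgue. f x * ?\<psi> x) = (LINT x|lebesgue. V x * ?\<psi> x)"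
      using \<phi> unfolding dist_eq_def dist_deriv_def regular_dist_def by simp
    then show "(LINT x|lebesgue. (f x - V x) * ?\<psi> x) = 0"
      using integrable_loc_integrable_mult[OF f R] integrable_loc_integrable_mult[OF Vi R]
      by (simp add: left_diff_distrib)
  qed
  then obtain c where c: "AE x in lebesgue. f x - V x = c" by blast
  have "primitive (\<lambda>x. c + V x) v"
    using primitive_add[OF primitive_const V, of c] by simp
  moreover have "AE x in lebesgue. c + V x = f x" using c by eventually_elim auto
  ultimately show ?thesis using that by blast
qed

lemma regular_dist_AE_cong:
  assumes "AE x in lebesgue. f x = g x" "f \<in> borel_measurable lebesgue" "g \<in> borel_measurable lebesgue"
  shows "dist_eq (regular_dist f) (regular_dist g)"
  unfolding dist_eq_def regular_dist_def
proof
  fix \<phi> assume "\<phi> \<in> test_functions"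
  then have "\<phi> \<in> borel_measurable lebesgue"
    using test_function_props loc_bounded_def by metis
  then show "(LINT x|lebesgue. f x * \<phi> x) = (LINT x|lebesgue. g x * \<phi> x)"
    using assms by (intro integral_cong_AE) (auto elim!: eventually_mono)
qed

text \<open>The definition of the Sobolev space gives a locally bounded function for each distributional
derivative separately. The du Bois-Reymond lemma links consecutive ones: starting from the
derivative of order \<open>m\<close> and going down, each is almost everywhere a primitive of the next. At order zero
the continuity of \<open>W\<close> turns equality almost everywhere into equality.\<close>
theorem Winf_loc_imp_sobolev:
  assumes W: "W \<in> Winf_loc m" and cont: "continuous_on UNIV W" and m: "m \<ge> 1"
  shows "sobolev m W"
proof -
  have "\<forall>k\<in>{..m}. \<exists>v. v \<in> Linf_loc \<and> dist_eq ((dist_deriv ^^ k) (regular_dist W)) (regular_dist v)"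
    using W unfolding Winf_loc_def by blast
  then obtain v where v: "\<And>k. k \<le> m \<Longrightarrow> v k \<in> Linf_loc"
    "\<And>k. k \<le> m \<Longrightarrow> dist_eq ((dist_deriv ^^ k) (regular_dist W)) (regular_dist (v k))"
    unfolding bchoice_iff by auto
  have "\<exists>w. sobolev j w \<and> (AE x in lebesgue. w x = v (m - j) x)" if "j \<le> m" for j
    using that
  proof (induction j)
    case 0
    then show ?case using Linf_loc_representative[OF v(1)[of m]] by auto
  next
    case (Suc j)
    define k where "k = m - Suc j"
    have k: "Suc k = m - j" "k \<le> m" "Suc k \<le> m" using Suc.prems by (auto simp: k_def)
    obtain w where w: "sobolev j w" "AE x in lebesgue. w x = v (Suc k) x"
      using Suc k by auto
    have wl: "loc_bounded w" using sobolev_loc_bounded[OF w(1)] .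
    have "dist_eq (dist_deriv (regular_dist (v k))) ((dist_deriv ^^ Suc k) (regular_dist W))"
      using dist_eq_deriv[OF dist_eq_sym[OF v(2)[OF k(2)]]] by simp
    also have "dist_eq \<dots> (regular_dist (v (Suc k)))" by (rule v(2)[OF k(3)])
    also have "dist_eq \<dots> (regular_dist w)"
      using w(2) wl v(1)[OF k(3)]
      by (intro dist_eq_sym[OF regular_dist_AE_cong]) (auto simp: loc_bounded_def Linf_loc_def)
    finally obtain w' where "primitive w' w" "AE x in lebesgue. w' x = v k x"
      using weak_derivative_imp_primitive[OF Linf_loc_loc_integrable[OF v(1)[OF k(2)]] wl] by metis
    then show ?case using w(1) by (auto simp: k_def)
  qed
  from this[of m] obtain w where w: "sobolev m w" "AE x in lebesgue. w x = v 0 x" by auto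
  have "AE x in lebesgue. W x = v 0 x"
    using v(2)[of 0]
    by (intro regular_dist_inj[OF loc_bounded_imp_loc_integrable[OF continuous_imp_loc_bounded[OF cont]]
          Linf_loc_loc_integrable[OF v(1)]]) auto
  then have "AE x in lebesgue. w x = W x" using w(2) by eventually_elim simp
  then have "w = W"
    by (rule continuous_AE_eq[OF sobolev_continuous[OF w(1) m] cont])
  then show ?thesis using w(1) by simp
qed

section \<open>Cutoffs and fourth roots\<close>

text \<open>Bootstrapping: if \<open>b\<close> has \<open>j\<close> derivatives, so has the right-hand side of the equation
\<open>b' = a b\<^sup>n\<close> as long as \<open>a\<close> has, and then \<open>b\<close> has one more.\<close>
lemma sobolev_ode:
  assumes a: "sobolev k a" and der: "\<And>x. (b has_vector_derivative a x * b x ^ n) (at x)"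
  shows "sobolev (Suc k) b"
proof -
  have b: "continuous_on UNIV b"
    using has_vector_derivative_continuous[OF der] by (simp add: continuous_on_eq_continuous_at)
  have "sobolev (Suc j) b" if "j \<le> k" for j
    using that
  proof (induction j)
    case 0
    have "loc_bounded (\<lambda>x. a x * b x ^ n)"
      using sobolev_loc_bounded[OF a] continuous_imp_loc_bounded[OF b]
      by (intro loc_bounded_mult loc_bounded_power)
    then show ?case using primitive_of_derivative[OF der] by auto
  next
    case (Suc j)
    have s: "sobolev (Suc j) (\<lambda>x. a x * b x ^ n)"
      using Suc by (intro sobolev_mult sobolev_power sobolev_mono[OF a]) auto
    show ?case
      unfolding sobolev.simps(2)[of "Suc j"]
      using s primitive_of_derivative[OF der sobolev_loc_bounded[OF s]] by blast
  qed
  then show ?thesis by simp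
qed

lemma sobolev_derivative:
  assumes "sobolev (Suc (Suc k)) f"
  obtains f' where "sobolev (Suc k) f'" "\<And>x. (f has_vector_derivative f' x) (at x)"
proof -
  obtain f' where f': "sobolev (Suc k) f'" "primitive f f'"
    using assms unfolding sobolev.simps(2)[of "Suc k"] by blast
  show ?thesis
    by (rule that[OF f'(1) primitive_has_derivative[OF f'(2) sobolev_continuous[OF f'(1)]]]) simp
qed

lemma sobolev_inverse:
  assumes f: "sobolev (Suc (Suc k)) f" and nz: "\<And>x. f x \<noteq> 0"
  shows "sobolev (Suc (Suc k)) (\<lambda>x. inverse (f x))"
proof -
  obtain f' where f': "sobolev (Suc k) f'" "\<And>x. (f has_vector_derivative f' x) (at x)"
    using sobolev_derivative[OF f] by blast
  show ?thesis
  proof (rule sobolev_ode[where n = 2])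
    show "sobolev (Suc k) (\<lambda>x. - f' x)" by (rule sobolev_uminus[OF f'(1)])
    fix x
    have "((\<lambda>z. inverse z) has_field_derivative - (inverse (f x) ^ 2)) (at (f x))"
      using nz[of x] by (auto intro!: derivative_eq_intros simp: power2_eq_square)
    then have "((\<lambda>z. inverse z) \<circ> f has_vector_derivative f' x * (- (inverse (f x) ^ 2))) (at x)"
      by (rule field_vector_diff_chain_at[OF f'(2)])
    then show "((\<lambda>x. inverse (f x)) has_vector_derivative - f' x * inverse (f x) ^ 2) (at x)"
      by (simp add: o_def)
  qed
qed

text \<open>The quotient \<open>A / (A + B)\<close> of smooth functions, where \<open>A\<close> is positive exactly on the larger interval and
\<open>B\<close> vanishes exactly on the smaller one.\<close>
lemma smooth_cutoff:
  assumes "0 < r" "r < R"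
  obtains \<eta> :: "real \<Rightarrow> real" where "\<And>k. sobolev k (\<lambda>x. of_real (\<eta> x))"
    "\<And>x. \<bar>x - x\<^sub>0\<bar> \<le> r \<Longrightarrow> \<eta> x = 1" "\<And>x. \<bar>x - x\<^sub>0\<bar> \<ge> R \<Longrightarrow> \<eta> x = 0"
    "\<And>x. 0 \<le> \<eta> x" "\<And>x. \<eta> x \<le> 1"
proof -
  \<comment> \<open>the real values of \<open>flat\<close>, for which positivity can be stated\<close>
  define e where "e s a x = (if s * (x - a) \<le> 0 then 0 else exp (- (1 / (s * (x - a)))))" for s a x :: real
  have e: "flat 1 s a x = of_real (e s a x)" for s a x by (simp add: flat_def e_def)
  have e0: "e s a x \<ge> 0" "e s a x > 0 \<longleftrightarrow> s * (x - a) > 0" for s a x by (auto simp: e_def)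
  define A where "A x = e 1 (x\<^sub>0 - R) x * e (-1) (x\<^sub>0 + R) x" for x
  define B where "B x = e 1 (x\<^sub>0 + r) x + e (-1) (x\<^sub>0 - r) x" for x
  have A0: "A x \<ge> 0" and B0: "B x \<ge> 0" for x by (auto simp: A_def B_def e0)
  have AB: "A x + B x > 0" for x
  proof (cases "\<bar>x - x\<^sub>0\<bar> < R")
    case True
    then have "A x > 0" unfolding A_def by (intro mult_pos_pos) (auto simp: e0)
    then show ?thesis using B0[of x] by simp
  next
    case False
    then have "B x > 0" unfolding B_def
      using assms e0(2)[of 1 "x\<^sub>0 + r" x] e0(2)[of "-1" "x\<^sub>0 - r" x] e0(1)
      by (cases "x > x\<^sub>0") (auto intro: add_pos_nonneg add_nonneg_pos)
    then show ?thesis using A0[of x] by simp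
  qed
  have sA: "sobolev k (\<lambda>x. of_real (A x))" for k
    using sobolev_mult[OF sobolev_flat[of 1 k 1 "x\<^sub>0 - R"] sobolev_flat[of "-1" k 1 "x\<^sub>0 + R"]]
    by (simp add: A_def e)
  have sB: "sobolev k (\<lambda>x. of_real (B x))" for k
    using sobolev_add[OF sobolev_flat[of 1 k 1 "x\<^sub>0 + r"] sobolev_flat[of "-1" k 1 "x\<^sub>0 - r"]]
    by (simp add: B_def e)
  have "sobolev (Suc (Suc k)) (\<lambda>x. of_real (A x) * inverse (of_real (A x) + of_real (B x)))" for k
    using AB by (intro sobolev_mult sA sobolev_inverse sobolev_add sB)
      (metis less_irrefl of_real_add of_real_eq_0_iff)
  then have s: "sobolev k (\<lambda>x. of_real (A x / (A x + B x)))" for k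
    using sobolev_mono[of "Suc (Suc k)" _ k] by (simp add: divide_inverse del: sobolev.simps)
  show ?thesis
  proof (rule that[of "\<lambda>x. A x / (A x + B x)", OF s])
    fix x
    show "A x / (A x + B x) = 1" if "\<bar>x - x\<^sub>0\<bar> \<le> r"
    proof -
      have "B x = 0" using that by (auto simp: B_def e_def)
      then show ?thesis using AB[of x] by simp
    qed
    show "A x / (A x + B x) = 0" if "\<bar>x - x\<^sub>0\<bar> \<ge> R"
    proof -
      have "A x = 0" using that by (auto simp: A_def e_def)
      then show ?thesis by simp
    qed
    show "0 \<le> A x / (A x + B x)" "A x / (A x + B x) \<le> 1"
      using A0[of x] B0[of x] AB[of x] by (simp_all add: divide_le_eq)
  qed
qed

text \<open>The reciprocal \<open>b\<close> of a fourth root of \<open>q\<close> satisfies \<open>b' = - q' b\<^sup>5 / 4\<close>, an equation that is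
polynomial in \<open>b\<close>, so \<open>sobolev_ode\<close> applies. The root itself is then \<open>q b\<^sup>3\<close>.\<close>
lemma sobolev_quartic_root:
  assumes q: "sobolev (Suc (Suc k)) q" and pos: "\<And>x. Re (q x) > 0" and \<sigma>: "\<sigma> ^ 4 = 1"
  defines "c \<equiv> \<lambda>x. \<sigma> * csqrt (csqrt (q x))"
  shows "c x ^ 4 = q x" "c x \<noteq> 0"
    "sobolev (Suc (Suc k)) (\<lambda>x. inverse (c x))" "sobolev (Suc (Suc k)) c"
proof -
  have \<sigma>0: "\<sigma> \<noteq> 0" using \<sigma> by auto
  have c4: "c x ^ 4 = q x" for x
  proof -
    have "csqrt (csqrt (q x)) ^ (2 * 2) = q x" by (simp only: power_mult power2_csqrt)
    then show ?thesis using \<sigma> by (simp add: c_def power_mult_distrib)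
  qed
  then show "c x ^ 4 = q x" .
  have c0: "c x \<noteq> 0" for x using c4[of x] pos[of x] by auto
  then show "c x \<noteq> 0" .
  obtain q' where q': "sobolev (Suc k) q'" "\<And>x. (q has_vector_derivative q' x) (at x)"
    using sobolev_derivative[OF q] by blast
  have nonneg: "q x \<notin> \<real>\<^sub>\<le>\<^sub>0" for x
    using pos[of x] by (auto simp: complex_nonpos_Reals_iff)
  have q0: "q x \<noteq> 0" for x using pos[of x] by auto
  show b: "sobolev (Suc (Suc k)) (\<lambda>x. inverse (c x))"
  proof (rule sobolev_ode[where n = 5])
    show "sobolev (Suc k) (\<lambda>x. - 1 / 4 * q' x)" by (intro sobolev_mult sobolev_const q'(1))
    fix x
    define r where "r = csqrt (csqrt (q x))"
    have r: "r \<noteq> 0" "csqrt (q x) = r\<^sup>2" using q0[of x] by (auto simp: r_def)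
    have "((\<lambda>z. inverse (\<sigma> * csqrt (csqrt z))) has_field_derivative
        - (\<sigma> * (1 / (2 * csqrt (q x)) * (1 / (2 * r)))) / (\<sigma> * r)\<^sup>2) (at (q x))"
      using nonneg[of x] q0[of x] \<sigma>0
      by (auto intro!: derivative_eq_intros simp: r_def field_simps power2_eq_square)
    moreover have "- (\<sigma> * (1 / (2 * csqrt (q x)) * (1 / (2 * r)))) / (\<sigma> * r)\<^sup>2
        = - 1 / 4 * inverse (\<sigma> * r) ^ 5"
    proof -
      have "\<sigma> ^ 5 = \<sigma>" using \<sigma> by (simp add: eval_nat_numeral)
      then have "inverse (\<sigma> * r) ^ 5 = 1 / (\<sigma> * r ^ 5)"
        by (simp add: power_inverse power_mult_distrib divide_inverse)
      then show ?thesis using r \<sigma>0 by (simp add: field_simps eval_nat_numeral)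
    qed
    ultimately have "((\<lambda>z. inverse (\<sigma> * csqrt (csqrt z))) has_field_derivative
        - 1 / 4 * inverse (\<sigma> * r) ^ 5) (at (q x))"
      by (simp only:)
    then have "((\<lambda>z. inverse (\<sigma> * csqrt (csqrt z))) \<circ> q has_vector_derivative
        q' x * (- 1 / 4 * inverse (\<sigma> * r) ^ 5)) (at x)"
      by (rule field_vector_diff_chain_at[OF q'(2)])
    then show "((\<lambda>x. inverse (c x)) has_vector_derivative - 1 / 4 * q' x * inverse (c x) ^ 5) (at x)"
      by (simp add: o_def c_def r_def mult.commute)
  qed
  have "c = (\<lambda>x. q x * inverse (c x) ^ 3)"
  proof
    fix x show "c x = q x * inverse (c x) ^ 3"
      using c0[of x] c4[of x] by (simp add: field_simps eval_nat_numeral)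
  qed
  then show "sobolev (Suc (Suc k)) c"
    using sobolev_mult[OF q sobolev_power[OF b, of 3]] by simp
qed

section \<open>Polynomials in the semiclassical parameter\<close>

text \<open>A value \<open>F x\<close> is a polynomial in \<open>h\<close>, and the coefficient of \<open>h\<^sup>j\<close> is allowed to lose \<open>j\<close> of the \<open>m\<close>
derivatives. This is the regularity that the recursion produces: the class is closed under
products, and the operation \<open>h d/dx\<close> shifts degree and regularity together. From degree \<open>m\<close> on only
local boundedness remains.\<close>
definition graded :: "nat \<Rightarrow> (real \<Rightarrow> complex poly) \<Rightarrow> bool" where
  "graded m F \<longleftrightarrow> (\<exists>M. \<forall>x. degree (F x) \<le> M) \<and> (\<forall>j. sobolev (m - j) (\<lambda>x. coeff (F x) j))"

lemma graded_const: "graded m (\<lambda>x. p)"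
  by (auto simp: graded_def)

lemma graded_monom:
  assumes "sobolev (m - n) c"
  shows "graded m (\<lambda>x. monom (c x) n)"
  unfolding graded_def
proof (intro conjI allI)
  show "\<exists>M. \<forall>x. degree (monom (c x) n) \<le> M" by (auto intro: degree_monom_le)
  show "sobolev (m - j) (\<lambda>x. coeff (monom (c x) n) j)" for j
    using assms by (cases "j = n") auto
qed

lemma graded_add:
  assumes "graded m F" "graded m G"
  shows "graded m (\<lambda>x. F x + G x)"
  unfolding graded_def
proof (intro conjI allI)
  obtain K L where "\<And>x. degree (F x) \<le> K" "\<And>x. degree (G x) \<le> L"
    using assms unfolding graded_def by blast
  then show "\<exists>M. \<forall>x. degree (F x + G x) \<le> M"
    by (intro exI[of _ "max K L"] allI degree_add_le) (auto intro: le_max_iff_disj[THEN iffD2])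
  show "sobolev (m - j) (\<lambda>x. coeff (F x + G x) j)" for j
    using assms by (simp add: graded_def sobolev_add)
qed

lemma graded_mult:
  assumes "graded m F" "graded m G"
  shows "graded m (\<lambda>x. F x * G x)"
  unfolding graded_def
proof (intro conjI allI)
  obtain K L where "\<And>x. degree (F x) \<le> K" "\<And>x. degree (G x) \<le> L"
    using assms unfolding graded_def by blast
  then show "\<exists>M. \<forall>x. degree (F x * G x) \<le> M"
    by (intro exI[of _ "K + L"] allI order_trans[OF degree_mult_le] add_mono) auto
  show "sobolev (m - j) (\<lambda>x. coeff (F x * G x) j)" for j
    unfolding coeff_mult
    using assms unfolding graded_def
    by (intro sobolev_sum sobolev_mult) (auto intro: sobolev_mono)
qed

lemma graded_power: "graded m F \<Longrightarrow> graded m (\<lambda>x. F x ^ n)"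
  by (induction n) (auto intro: graded_mult graded_const)

lemma graded_diff: "graded m F \<Longrightarrow> graded m G \<Longrightarrow> graded m (\<lambda>x. F x - G x)"
  using graded_add[OF _ graded_mult[OF graded_const[of m "-1"]], of F G] by simp

lemma poly_eval_sum:
  fixes p :: "complex poly"
  assumes "degree p \<le> M"
  shows "poly p h = (\<Sum>j\<le>M. coeff p j * h ^ j)"
  using arg_cong[OF poly_as_sum_of_monoms'[OF assms], of "\<lambda>p. poly p h"]
  by (simp add: poly_sum poly_monom)

lemma graded_eval_bound:
  assumes F: "graded m F" and z: "\<And>x j. j < s \<Longrightarrow> coeff (F x) j = 0"
  obtains C where "C > 0"
    "\<And>x h. \<bar>x\<bar> \<le> R \<Longrightarrow> 0 < h \<Longrightarrow> h \<le> 1 \<Longrightarrow> norm (poly (F x) (of_real h)) \<le> C * h ^ s"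
proof -
  obtain M where M: "\<And>x. degree (F x) \<le> M" using F unfolding graded_def by blast
  have "\<exists>B. B > 0 \<and> (\<forall>x. \<bar>x\<bar> \<le> R \<longrightarrow> norm (coeff (F x) j) \<le> B)" for j
    using F loc_bounded_bound[OF sobolev_loc_bounded] unfolding graded_def by metis
  then obtain B where B: "\<And>j. B j > 0" "\<And>j x. \<bar>x\<bar> \<le> R \<Longrightarrow> norm (coeff (F x) j) \<le> B j"
    by metis
  show ?thesis
  proof (rule that[of "\<Sum>j\<le>M. B j"])
    show "(\<Sum>j\<le>M. B j) > 0" by (intro sum_pos) (auto simp: B)
    fix x h :: real assume x: "\<bar>x\<bar> \<le> R" and h: "0 < h" "h \<le> 1"
    have "poly (F x) (of_real h) = (\<Sum>j\<le>M. coeff (F x) j * of_real h ^ j)"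
      by (rule poly_eval_sum[OF M])
    also have "norm \<dots> \<le> (\<Sum>j\<le>M. B j * h ^ s)"
    proof (rule sum_norm_le)
      fix j
      show "norm (coeff (F x) j * of_real h ^ j) \<le> B j * h ^ s"
      proof (cases "j < s")
        case True
        then show ?thesis using z B(1)[of j] h by (simp add: less_imp_le)
      next
        case False
        then have "h ^ j \<le> h ^ s" using h by (intro power_decreasing) auto
        then show ?thesis
          using B(1)[of j] B(2)[OF x, of j] h
          by (simp add: norm_mult norm_power mult_mono)
      qed
    qed
    finally show "norm (poly (F x) (of_real h)) \<le> (\<Sum>j\<le>M. B j) * h ^ s"
      by (simp add: sum_distrib_right)
  qed
qed

section \<open>The formal WKB solution\<close>

text \<open>The factor \<open>h\<^sup>4 (d\<^sup>4e/dx\<^sup>4) / e\<close> for \<open>e = exp (\<phi> / h)\<close>, in terms of \<open>a\<^sub>k = h\<^sup>k (d\<^sup>k/dx\<^sup>k) \<phi>'\<close>.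
It is needed for polynomials in \<open>h\<close> as well as for their values.\<close>
definition riccati :: "'a::comm_ring_1 \<Rightarrow> 'a \<Rightarrow> 'a \<Rightarrow> 'a \<Rightarrow> 'a" where
  "riccati a\<^sub>0 a\<^sub>1 a\<^sub>2 a\<^sub>3 = a\<^sub>0 ^ 4 + 6 * a\<^sub>0\<^sup>2 * a\<^sub>1 + 4 * a\<^sub>0 * a\<^sub>2 + 3 * a\<^sub>1\<^sup>2 + a\<^sub>3"

lemma graded_riccati:
  "graded m A\<^sub>0 \<Longrightarrow> graded m A\<^sub>1 \<Longrightarrow> graded m A\<^sub>2 \<Longrightarrow> graded m A\<^sub>3 \<Longrightarrow>
   graded m (\<lambda>x. riccati (A\<^sub>0 x) (A\<^sub>1 x) (A\<^sub>2 x) (A\<^sub>3 x))"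
  unfolding riccati_def by (intro graded_add graded_mult graded_power graded_const)

text \<open>Here \<open>X\<close> stands for \<open>h\<close> and \<open>Y\<close> for the power of \<open>h\<close> at which a correction is inserted. As the derivatives of
the leading term carry a factor \<open>X\<close>, the correction enters at order \<open>Y\<close> only through the linear term of the
fourth power.\<close>
lemma riccati_perturb:
  fixes a\<^sub>0 :: "'a::comm_ring_1"
  assumes "Y = X * Y'" "a\<^sub>1 = X * b\<^sub>1" "a\<^sub>2 = X * b\<^sub>2"
  shows "\<exists>S. riccati (a\<^sub>0 + c\<^sub>0 * Y) (a\<^sub>1 + c\<^sub>1 * (X * Y)) (a\<^sub>2 + c\<^sub>2 * (X\<^sup>2 * Y)) (a\<^sub>3 + c\<^sub>3 * (X ^ 3 * Y))
    = riccati a\<^sub>0 a\<^sub>1 a\<^sub>2 a\<^sub>3 + Y * (4 * a\<^sub>0 ^ 3 * c\<^sub>0 + X * S)"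
proof
  show "riccati (a\<^sub>0 + c\<^sub>0 * Y) (a\<^sub>1 + c\<^sub>1 * (X * Y)) (a\<^sub>2 + c\<^sub>2 * (X\<^sup>2 * Y)) (a\<^sub>3 + c\<^sub>3 * (X ^ 3 * Y))
    = riccati a\<^sub>0 a\<^sub>1 a\<^sub>2 a\<^sub>3 + Y * (4 * a\<^sub>0 ^ 3 * c\<^sub>0 + X *
        (Y' * (6 * a\<^sub>0\<^sup>2 * c\<^sub>0\<^sup>2 + 4 * a\<^sub>0 * c\<^sub>0 ^ 3 * Y + c\<^sub>0 ^ 4 * Y\<^sup>2)
         + 6 * ((2 * a\<^sub>0 * c\<^sub>0 + c\<^sub>0\<^sup>2 * Y) * b\<^sub>1 + (a\<^sub>0 + c\<^sub>0 * Y)\<^sup>2 * c\<^sub>1)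
         + 4 * (c\<^sub>0 * b\<^sub>2 + (a\<^sub>0 + c\<^sub>0 * Y) * c\<^sub>2 * X)
         + 6 * a\<^sub>1 * c\<^sub>1 + 3 * c\<^sub>1\<^sup>2 * X * Y + c\<^sub>3 * X\<^sup>2))"
    unfolding riccati_def assms by (simp add: eval_nat_numeral algebra_simps)
qed

text \<open>The relation \<open>A' = h dA/dx\<close>, expressed for the values at nonzero \<open>h\<close>.\<close>
definition scaled_primitive :: "(real \<Rightarrow> complex poly) \<Rightarrow> (real \<Rightarrow> complex poly) \<Rightarrow> bool" where
  "scaled_primitive A A' \<longleftrightarrow>
     (\<forall>h. h \<noteq> 0 \<longrightarrow> primitive (\<lambda>x. poly (A x) h) (\<lambda>x. poly (A' x) h / h))"

lemma scaled_primitive_add: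
  "scaled_primitive A A' \<Longrightarrow> scaled_primitive B B' \<Longrightarrow> scaled_primitive (\<lambda>x. A x + B x) (\<lambda>x. A' x + B' x)"
  unfolding scaled_primitive_def
  using primitive_add by (fastforce simp: add_divide_distrib)

lemma scaled_primitive_monom:
  assumes "primitive c c'"
  shows "scaled_primitive (\<lambda>x. monom (c x) n) (\<lambda>x. monom (c' x) (Suc n))"
  unfolding scaled_primitive_def
proof (intro allI impI)
  fix h :: complex assume "h \<noteq> 0"
  then show "primitive (\<lambda>x. poly (monom (c x) n) h) (\<lambda>x. poly (monom (c' x) (Suc n)) h / h)"
    using primitive_cmult[OF assms, of "h ^ n"] by (simp add: poly_monom mult.commute)
qed

lemma monom_one_dvd_monom: "monom 1 1 dvd (monom c (Suc n) :: complex poly)"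
  by (rule dvdI[of _ _ "monom c n"]) (simp add: mult_monom)

lemma sobolev_three_derivatives:
  assumes "sobolev (Suc (Suc (Suc k))) f"
  obtains f\<^sub>1 f\<^sub>2 f\<^sub>3 where "sobolev (Suc (Suc k)) f\<^sub>1" "primitive f f\<^sub>1"
    "sobolev (Suc k) f\<^sub>2" "primitive f\<^sub>1 f\<^sub>2" "sobolev k f\<^sub>3" "primitive f\<^sub>2 f\<^sub>3"
proof -
  obtain f1 where f1: "sobolev (Suc (Suc k)) f1" "primitive f f1"
    using assms unfolding sobolev.simps(2)[of "Suc (Suc k)"] by blast
  obtain f2 where f2: "sobolev (Suc k) f2" "primitive f1 f2"
    using f1(1) unfolding sobolev.simps(2)[of "Suc k"] by blast
  obtain f3 where "sobolev k f3" "primitive f2 f3"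
    using f2(1) unfolding sobolev.simps(2)[of k] by blast
  then show ?thesis using that f1 f2 by blast
qed

text \<open>By induction on the order \<open>n\<close> up to which the residual vanishes. If \<open>d\<close> is the
residual coefficient of order \<open>n + 1\<close>, the correction \<open>u h^(n + 1)\<close> changes it to \<open>d + 4 c\<^sup>3 u\<close>, so
\<open>u = - d / (4 c\<^sup>3)\<close> is the only choice. The coefficient \<open>d\<close> has \<open>N + 3 - (n + 1)\<close> derivatives, at least the
three that are needed for the new \<open>A\<^sub>1\<close>, \<open>A\<^sub>2\<close> and \<open>A\<^sub>3\<close>.\<close>
lemma formal_wkb_solution:
  assumes q: "sobolev (N + 3) q" and c: "sobolev (N + 3) c" and ic: "sobolev (N + 3) (\<lambda>x. inverse (c x))"
    and c4: "\<And>x. c x ^ 4 = q x" and nz: "\<And>x. c x \<noteq> 0" and n: "n \<le> N"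
  shows "\<exists>A\<^sub>0 A\<^sub>1 A\<^sub>2 A\<^sub>3.
    graded (N + 3) A\<^sub>0 \<and> graded (N + 3) A\<^sub>1 \<and> graded (N + 3) A\<^sub>2 \<and> graded (N + 3) A\<^sub>3 \<and>
    scaled_primitive A\<^sub>0 A\<^sub>1 \<and> scaled_primitive A\<^sub>1 A\<^sub>2 \<and> scaled_primitive A\<^sub>2 A\<^sub>3 \<and>
    (\<forall>x. coeff (A\<^sub>0 x) 0 = c x \<and> monom 1 1 dvd A\<^sub>1 x \<and> monom 1 1 dvd A\<^sub>2 x) \<and>
    (\<forall>x. \<forall>j\<le>n. coeff (riccati (A\<^sub>0 x) (A\<^sub>1 x) (A\<^sub>2 x) (A\<^sub>3 x) - [:q x:]) j = 0)"
  using n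
proof (induction n)
  case 0
  have "sobolev (Suc (Suc (Suc N))) c" using c by (simp add: numeral_3_eq_3 del: sobolev.simps)
  then obtain c1 c2 c3 where c1: "sobolev (Suc (Suc N)) c1" "primitive c c1"
    and c2: "sobolev (Suc N) c2" "primitive c1 c2" and c3: "sobolev N c3" "primitive c2 c3"
    by (rule sobolev_three_derivatives)
  let ?A0 = "\<lambda>x. monom (c x) 0" and ?A1 = "\<lambda>x. monom (c1 x) (Suc 0)"
    and ?A2 = "\<lambda>x. monom (c2 x) (Suc (Suc 0))" and ?A3 = "\<lambda>x. monom (c3 x) (Suc (Suc (Suc 0)))"
  show ?case
  proof (rule exI[of _ ?A0], rule exI[of _ ?A1], rule exI[of _ ?A2], rule exI[of _ ?A3],
      intro conjI allI impI)
    show "graded (N + 3) ?A0" "graded (N + 3) ?A1" "graded (N + 3) ?A2" "graded (N + 3) ?A3"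
      using c c1(1) c2(1) c3(1)
      by (auto intro!: graded_monom simp: numeral_3_eq_3 simp del: sobolev.simps)
    show "scaled_primitive ?A0 ?A1" "scaled_primitive ?A1 ?A2" "scaled_primitive ?A2 ?A3"
      using c1 c2 c3 by (auto intro: scaled_primitive_monom)
    show "monom 1 1 dvd ?A1 x" "monom 1 1 dvd ?A2 x" for x
      by (rule monom_one_dvd_monom)+
    fix x j assume "j \<le> (0::nat)"
    then show "coeff (riccati (?A0 x) (?A1 x) (?A2 x) (?A3 x) - [:q x:]) j = 0"
      using c4[of x] by (simp add: riccati_def poly_monom flip: poly_0_coeff_0)
  qed simp
next
  case (Suc n)
  then obtain A0 A1 A2 A3 where
    G: "graded (N + 3) A0" "graded (N + 3) A1" "graded (N + 3) A2" "graded (N + 3) A3"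
    and D: "scaled_primitive A0 A1" "scaled_primitive A1 A2" "scaled_primitive A2 A3"
    and c0: "\<And>x. coeff (A0 x) 0 = c x" and dv: "\<And>x. monom 1 1 dvd A1 x" "\<And>x. monom 1 1 dvd A2 x"
    and R: "\<And>x j. j \<le> n \<Longrightarrow> coeff (riccati (A0 x) (A1 x) (A2 x) (A3 x) - [:q x:]) j = 0"
    by auto
  define d where "d x = coeff (riccati (A0 x) (A1 x) (A2 x) (A3 x)) (Suc n)" for x
  \<comment> \<open>the solution of \<open>d + 4 c\<^sup>3 u = 0\<close>\<close>
  define u where "u x = - 1 / 4 * inverse (c x) ^ 3 * d x" for x
  define k where "k = N - Suc n"
  have k: "N + 3 - Suc n = Suc (Suc (Suc k))" using Suc.prems by (simp add: k_def)
  have "sobolev (N + 3 - Suc n) d"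
    using graded_riccati[OF G] unfolding graded_def d_def by blast
  then have "sobolev (N + 3 - Suc n) u"
    unfolding u_def by (intro sobolev_mult sobolev_const sobolev_power sobolev_mono[OF ic]) auto
  note u = this[unfolded k]
  then obtain u1 u2 u3 where u1: "sobolev (Suc (Suc k)) u1" "primitive u u1"
    and u2: "sobolev (Suc k) u2" "primitive u1 u2" and u3: "sobolev k u3" "primitive u2 u3"
    by (rule sobolev_three_derivatives)
  let ?A0 = "\<lambda>x. A0 x + monom (u x) (Suc n)"
    and ?A1 = "\<lambda>x. A1 x + monom (u1 x) (Suc (Suc n))"
    and ?A2 = "\<lambda>x. A2 x + monom (u2 x) (Suc (Suc (Suc n)))"
    and ?A3 = "\<lambda>x. A3 x + monom (u3 x) (Suc (Suc (Suc (Suc n))))"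
  show ?case
  proof (rule exI[of _ ?A0], rule exI[of _ ?A1], rule exI[of _ ?A2], rule exI[of _ ?A3],
      intro conjI allI impI)
    have "N + 3 - Suc (Suc n) = Suc (Suc k)" "N + 3 - Suc (Suc (Suc n)) = Suc k"
      "N + 3 - Suc (Suc (Suc (Suc n))) = k" using k by auto
    then have "sobolev (N + 3 - Suc n) u" "sobolev (N + 3 - Suc (Suc n)) u1"
      "sobolev (N + 3 - Suc (Suc (Suc n))) u2" "sobolev (N + 3 - Suc (Suc (Suc (Suc n)))) u3"
      using u u1(1) u2(1) u3(1) k by (simp_all only:)
    note s = this
    show "graded (N + 3) ?A0" "graded (N + 3) ?A1" "graded (N + 3) ?A2" "graded (N + 3) ?A3"
      by (intro graded_add G graded_monom s)+
    show "scaled_primitive ?A0 ?A1" "scaled_primitive ?A1 ?A2" "scaled_primitive ?A2 ?A3"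
      using u1 u2 u3 by (auto intro: scaled_primitive_add D scaled_primitive_monom)
    show "coeff (?A0 x) 0 = c x" for x using c0 by simp
    show "monom 1 1 dvd ?A1 x" "monom 1 1 dvd ?A2 x" for x
      by (intro dvd_add dv monom_one_dvd_monom)+
    fix x j assume j: "j \<le> Suc n"
    let ?X = "monom 1 1 :: complex poly" and ?Y = "monom 1 (Suc n) :: complex poly"
    obtain b1 b2 where b: "A1 x = ?X * b1" "A2 x = ?X * b2"
      using dv[of x] by (auto elim!: dvdE)
    have Y: "?Y = ?X * monom 1 n" by (simp add: mult_monom)
    obtain S where S: "riccati (A0 x + [:u x:] * ?Y) (A1 x + [:u1 x:] * (?X * ?Y))
        (A2 x + [:u2 x:] * (?X\<^sup>2 * ?Y)) (A3 x + [:u3 x:] * (?X ^ 3 * ?Y))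
      = riccati (A0 x) (A1 x) (A2 x) (A3 x) + ?Y * (4 * A0 x ^ 3 * [:u x:] + ?X * S)"
      using riccati_perturb[OF Y b] by blast
    have "coeff (4 * A0 x ^ 3 * [:u x:] + ?X * S) 0 = 4 * c x ^ 3 * u x"
      using c0[of x] by (simp add: poly_monom flip: poly_0_coeff_0)
    also have "\<dots> = - d x"
      using nz[of x] by (simp add: u_def field_simps power_inverse)
    finally have "coeff (?Y * (4 * A0 x ^ 3 * [:u x:] + ?X * S)) j = (if j = Suc n then - d x else 0)"
      using j by (auto simp: coeff_monom_mult)
    moreover have "[:u x:] * ?Y = monom (u x) (Suc n)" "[:u1 x:] * (?X * ?Y) = monom (u1 x) (Suc (Suc n))"
      "[:u2 x:] * (?X\<^sup>2 * ?Y) = monom (u2 x) (Suc (Suc (Suc n)))"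
      "[:u3 x:] * (?X ^ 3 * ?Y) = monom (u3 x) (Suc (Suc (Suc (Suc n))))"
      by (simp_all add: mult_monom monom_power smult_monom eval_nat_numeral)
    ultimately show "coeff (riccati (?A0 x) (?A1 x) (?A2 x) (?A3 x) - [:q x:]) j = 0"
      using S R[of j x] j by (cases "j = Suc n") (auto simp: d_def)
  qed
qed

section \<open>Derivatives of the ansatz\<close>

lemma primitive_exp:
  assumes "primitive \<phi> p" "continuous_on UNIV p"
  shows "primitive (\<lambda>x. exp (\<phi> x)) (\<lambda>x. p x * exp (\<phi> x))"
proof (rule primitive_of_derivative)
  fix x
  have "(exp \<circ> \<phi> has_vector_derivative p x * exp (\<phi> x)) (at x)"
    by (rule field_vector_diff_chain_at[OF primitive_has_derivative[OF assms]]) (rule DERIV_exp)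
  then show "((\<lambda>x. exp (\<phi> x)) has_vector_derivative p x * exp (\<phi> x)) (at x)"
    by (simp add: o_def)
next
  show "loc_bounded (\<lambda>x. p x * exp (\<phi> x))"
    using assms primitive_continuous[OF assms(1)]
    by (intro continuous_imp_loc_bounded continuous_intros)
qed

lemma primitive_mult_exponential:
  assumes P: "primitive P (\<lambda>x. P' x / h)" and e: "primitive e (\<lambda>x. a x * e x / h)"
  shows "primitive (\<lambda>x. P x * e x) (\<lambda>x. (P' x + a x * P x) * e x / h)"
  using primitive_mult[OF P e] by (simp add: field_simps add_divide_distrib)

lemma exponential_derivatives:
  assumes a01: "primitive a\<^sub>0 (\<lambda>x. a\<^sub>1 x / h)" and a12: "primitive a\<^sub>1 (\<lambda>x. a\<^sub>2 x / h)"
    and a23: "primitive a\<^sub>2 (\<lambda>x. a\<^sub>3 x / h)" and e: "primitive e (\<lambda>x. a\<^sub>0 x * e x / h)"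
    and h: "h \<noteq> 0"
  shows "primitive (\<lambda>x. a\<^sub>0 x * e x / h) (\<lambda>x. (a\<^sub>0 x ^ 2 + a\<^sub>1 x) * e x / h ^ 2)"
    "primitive (\<lambda>x. (a\<^sub>0 x ^ 2 + a\<^sub>1 x) * e x / h ^ 2)
       (\<lambda>x. (a\<^sub>0 x ^ 3 + 3 * a\<^sub>0 x * a\<^sub>1 x + a\<^sub>2 x) * e x / h ^ 3)"
    "primitive (\<lambda>x. (a\<^sub>0 x ^ 3 + 3 * a\<^sub>0 x * a\<^sub>1 x + a\<^sub>2 x) * e x / h ^ 3)
       (\<lambda>x. riccati (a\<^sub>0 x) (a\<^sub>1 x) (a\<^sub>2 x) (a\<^sub>3 x) * e x / h ^ 4)"
proof -
  have sq: "primitive (\<lambda>x. a\<^sub>0 x * a\<^sub>0 x) (\<lambda>x. (a\<^sub>1 x * a\<^sub>0 x + a\<^sub>0 x * a\<^sub>1 x) / h)"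
    using primitive_mult[OF a01 a01] by (simp add: add_divide_distrib)
  have cu: "primitive (\<lambda>x. a\<^sub>0 x * (a\<^sub>0 x * a\<^sub>0 x)) (\<lambda>x. (3 * a\<^sub>0 x ^ 2 * a\<^sub>1 x) / h)"
    using primitive_mult[OF a01 sq] by (simp add: power2_eq_square field_simps add_divide_distrib)
  have pr: "primitive (\<lambda>x. a\<^sub>0 x * a\<^sub>1 x) (\<lambda>x. (a\<^sub>1 x ^ 2 + a\<^sub>0 x * a\<^sub>2 x) / h)"
    using primitive_mult[OF a01 a12] by (simp add: power2_eq_square add_divide_distrib)
  have 2: "primitive (\<lambda>x. a\<^sub>0 x ^ 2 + a\<^sub>1 x) (\<lambda>x. (2 * a\<^sub>0 x * a\<^sub>1 x + a\<^sub>2 x) / h)"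
    using primitive_add[OF sq a12] by (simp add: power2_eq_square field_simps add_divide_distrib)
  have 3: "primitive (\<lambda>x. a\<^sub>0 x ^ 3 + 3 * a\<^sub>0 x * a\<^sub>1 x + a\<^sub>2 x)
      (\<lambda>x. (3 * a\<^sub>0 x ^ 2 * a\<^sub>1 x + 3 * (a\<^sub>1 x ^ 2 + a\<^sub>0 x * a\<^sub>2 x) + a\<^sub>3 x) / h)"
    using primitive_add[OF primitive_add[OF cu primitive_cmult[OF pr, of 3]] a23]
    by (simp add: power3_eq_cube mult.assoc add_divide_distrib)
  show "primitive (\<lambda>x. a\<^sub>0 x * e x / h) (\<lambda>x. (a\<^sub>0 x ^ 2 + a\<^sub>1 x) * e x / h ^ 2)"
    using primitive_divide_const[OF primitive_mult_exponential[OF a01 e], of h]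
    by (simp add: power2_eq_square algebra_simps)
  show "primitive (\<lambda>x. (a\<^sub>0 x ^ 2 + a\<^sub>1 x) * e x / h ^ 2)
       (\<lambda>x. (a\<^sub>0 x ^ 3 + 3 * a\<^sub>0 x * a\<^sub>1 x + a\<^sub>2 x) * e x / h ^ 3)"
    using primitive_divide_const[OF primitive_mult_exponential[OF 2 e], of "h ^ 2"]
    by (simp add: eval_nat_numeral algebra_simps)
  have *: "3 * a\<^sub>0 x ^ 2 * a\<^sub>1 x + 3 * (a\<^sub>1 x ^ 2 + a\<^sub>0 x * a\<^sub>2 x) + a\<^sub>3 x
        + a\<^sub>0 x * (a\<^sub>0 x ^ 3 + 3 * a\<^sub>0 x * a\<^sub>1 x + a\<^sub>2 x)
      = riccati (a\<^sub>0 x) (a\<^sub>1 x) (a\<^sub>2 x) (a\<^sub>3 x)" for x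
    unfolding riccati_def by (simp add: eval_nat_numeral algebra_simps)
  have h4: "h * h ^ 3 = h ^ 4" by (simp add: eval_nat_numeral)
  show "primitive (\<lambda>x. (a\<^sub>0 x ^ 3 + 3 * a\<^sub>0 x * a\<^sub>1 x + a\<^sub>2 x) * e x / h ^ 3)
       (\<lambda>x. riccati (a\<^sub>0 x) (a\<^sub>1 x) (a\<^sub>2 x) (a\<^sub>3 x) * e x / h ^ 4)"
    using primitive_divide_const[OF primitive_mult_exponential[OF 3 e], of "h ^ 3"]
    by (simp only: * divide_divide_eq_left h4)
qed

lemma fourth_derivative_product:
  assumes f: "primitive f\<^sub>0 f\<^sub>1" "primitive f\<^sub>1 f\<^sub>2" "primitive f\<^sub>2 f\<^sub>3" "primitive f\<^sub>3 f\<^sub>4"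
    and g: "primitive g\<^sub>0 g\<^sub>1" "primitive g\<^sub>1 g\<^sub>2" "primitive g\<^sub>2 g\<^sub>3" "primitive g\<^sub>3 g\<^sub>4"
  obtains u\<^sub>1 u\<^sub>2 u\<^sub>3 where "primitive (\<lambda>x. f\<^sub>0 x * g\<^sub>0 x) u\<^sub>1" "primitive u\<^sub>1 u\<^sub>2" "primitive u\<^sub>2 u\<^sub>3"
    "primitive u\<^sub>3 (\<lambda>x. f\<^sub>0 x * g\<^sub>4 x + 4 * f\<^sub>1 x * g\<^sub>3 x + 6 * f\<^sub>2 x * g\<^sub>2 x + 4 * f\<^sub>3 x * g\<^sub>1 x + f\<^sub>4 x * g\<^sub>0 x)"
proof -
  have 1: "primitive (\<lambda>x. f\<^sub>0 x * g\<^sub>0 x) (\<lambda>x. f\<^sub>1 x * g\<^sub>0 x + f\<^sub>0 x * g\<^sub>1 x)" by (intro primitive_add primitive_mult f g)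
  have 2: "primitive (\<lambda>x. f\<^sub>1 x * g\<^sub>0 x + f\<^sub>0 x * g\<^sub>1 x)
      (\<lambda>x. (f\<^sub>2 x * g\<^sub>0 x + f\<^sub>1 x * g\<^sub>1 x) + (f\<^sub>1 x * g\<^sub>1 x + f\<^sub>0 x * g\<^sub>2 x))" by (intro primitive_add primitive_mult f g)
  have 3: "primitive (\<lambda>x. (f\<^sub>2 x * g\<^sub>0 x + f\<^sub>1 x * g\<^sub>1 x) + (f\<^sub>1 x * g\<^sub>1 x + f\<^sub>0 x * g\<^sub>2 x))
      (\<lambda>x. ((f\<^sub>3 x * g\<^sub>0 x + f\<^sub>2 x * g\<^sub>1 x) + (f\<^sub>2 x * g\<^sub>1 x + f\<^sub>1 x * g\<^sub>2 x))
        + ((f\<^sub>2 x * g\<^sub>1 x + f\<^sub>1 x * g\<^sub>2 x) + (f\<^sub>1 x * g\<^sub>2 x + f\<^sub>0 x * g\<^sub>3 x)))"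
    (is "primitive _ ?u3") by (intro primitive_add primitive_mult f g)
  have "primitive ?u3
      (\<lambda>x. (((f\<^sub>4 x * g\<^sub>0 x + f\<^sub>3 x * g\<^sub>1 x) + (f\<^sub>3 x * g\<^sub>1 x + f\<^sub>2 x * g\<^sub>2 x))
        + ((f\<^sub>3 x * g\<^sub>1 x + f\<^sub>2 x * g\<^sub>2 x) + (f\<^sub>2 x * g\<^sub>2 x + f\<^sub>1 x * g\<^sub>3 x)))
        + (((f\<^sub>3 x * g\<^sub>1 x + f\<^sub>2 x * g\<^sub>2 x) + (f\<^sub>2 x * g\<^sub>2 x + f\<^sub>1 x * g\<^sub>3 x))
        + ((f\<^sub>2 x * g\<^sub>2 x + f\<^sub>1 x * g\<^sub>3 x) + (f\<^sub>1 x * g\<^sub>3 x + f\<^sub>0 x * g\<^sub>4 x))))"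
    by (intro primitive_add primitive_mult f g)
  then have "primitive ?u3
      (\<lambda>x. f\<^sub>0 x * g\<^sub>4 x + 4 * f\<^sub>1 x * g\<^sub>3 x + 6 * f\<^sub>2 x * g\<^sub>2 x + 4 * f\<^sub>3 x * g\<^sub>1 x + f\<^sub>4 x * g\<^sub>0 x)"
    by (simp add: algebra_simps)
  then show ?thesis using that 1 2 3 by blast
qed

lemma smooth_derivative_vanishes:
  assumes f: "\<And>k. sobolev k f" and const: "\<And>x. x \<in> S \<Longrightarrow> \<exists>T c. open T \<and> x \<in> T \<and> (\<forall>y\<in>T. f y = c)"
  obtains g where "\<And>k. sobolev k g" "primitive f g" "\<And>x. x \<in> S \<Longrightarrow> g x = 0"
proof -
  obtain g where g: "\<And>k. sobolev k g" "primitive f g" "\<And>x. (f has_vector_derivative g x) (at x)"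
    using smooth_derivative[OF f] by blast
  have "g x = 0" if x: "x \<in> S" for x
  proof -
    obtain T c where T: "open T" "x \<in> T" "\<And>y. y \<in> T \<Longrightarrow> f y = c" using const[OF x] by blast
    have "((\<lambda>_. c) has_vector_derivative 0) (at x)" by simp
    then have "(f has_vector_derivative 0) (at x)"
      by (rule has_vector_derivative_transform_within_open[OF _ T(1,2)]) (use T(3) in simp)
    then show ?thesis using g(3) vector_derivative_unique_at by blast
  qed
  then show ?thesis using that g by blast
qed

text \<open>For a cutoff, \<open>S\<close> consists of the interior of the set where it equals 1 and of the complement of its
support.\<close>
lemma smooth_four_derivatives:
  assumes f: "\<And>k. sobolev k f" and S: "open S"
    and const: "\<And>x. x \<in> S \<Longrightarrow> \<exists>T c. open T \<and> x \<in> T \<and> (\<forall>y\<in>T. f y = c)"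
  obtains f\<^sub>1 f\<^sub>2 f\<^sub>3 f\<^sub>4 where
    "primitive f f\<^sub>1" "primitive f\<^sub>1 f\<^sub>2" "primitive f\<^sub>2 f\<^sub>3" "primitive f\<^sub>3 f\<^sub>4"
    "\<And>x. x \<in> S \<Longrightarrow> f\<^sub>1 x = 0 \<and> f\<^sub>2 x = 0 \<and> f\<^sub>3 x = 0 \<and> f\<^sub>4 x = 0"
proof -
  have z: "\<exists>T c. open T \<and> x \<in> T \<and> (\<forall>y\<in>T. g y = c)" if "x \<in> S" "\<And>x. x \<in> S \<Longrightarrow> g x = 0"
    for x and g :: "real \<Rightarrow> complex"
    using S that by blast
  obtain f1 where f1: "\<And>k. sobolev k f1" "primitive f f1" "\<And>x. x \<in> S \<Longrightarrow> f1 x = 0"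
    using smooth_derivative_vanishes[OF f const] by blast
  obtain f2 where f2: "\<And>k. sobolev k f2" "primitive f1 f2" "\<And>x. x \<in> S \<Longrightarrow> f2 x = 0"
    using smooth_derivative_vanishes[OF f1(1) z[OF _ f1(3)]] by blast
  obtain f3 where f3: "\<And>k. sobolev k f3" "primitive f2 f3" "\<And>x. x \<in> S \<Longrightarrow> f3 x = 0"
    using smooth_derivative_vanishes[OF f2(1) z[OF _ f2(3)]] by blast
  obtain f4 where f4: "\<And>k. sobolev k f4" "primitive f3 f4" "\<And>x. x \<in> S \<Longrightarrow> f4 x = 0"
    using smooth_derivative_vanishes[OF f3(1) z[OF _ f3(3)]] by blast
  show ?thesis using that f1 f2 f3 f4 by blast
qed

section \<open>The operator on compactly supported functions\<close>

lemma loc_bounded_norm_power2_integrable: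
  assumes "loc_bounded u" "\<And>x. \<bar>x\<bar> > R \<Longrightarrow> u x = 0"
  shows "integrable lebesgue (\<lambda>x. (norm (u x))\<^sup>2)"
proof -
  have "integrable lebesgue (\<lambda>x. norm (u x * u x))"
    by (intro integrable_norm loc_bounded_integral_eq(1)[where R = R] loc_bounded_mult)
      (use assms in auto)
  then show ?thesis by (simp add: norm_mult power2_eq_square)
qed

lemma loc_bounded_L2:
  assumes "loc_bounded u" "\<And>x. \<bar>x\<bar> > R \<Longrightarrow> u x = 0"
  shows "u \<in> L2"
  unfolding L2_def using assms loc_bounded_norm_power2_integrable[OF assms]
  by (auto simp: loc_bounded_def)

text \<open>The distribution in the definition of the operator is represented by \<open>f = h\<^sup>4 u\<^sub>4 + W u\<close>. The
representative that the definition chooses is another locally integrable function of the same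
distribution, so it agrees with \<open>f\<close> almost everywhere and has the same norms.\<close>
lemma biharmonic_op_compact_support:
  assumes W: "continuous_on UNIV W"
    and u: "primitive u u\<^sub>1" "primitive u\<^sub>1 u\<^sub>2" "primitive u\<^sub>2 u\<^sub>3" "primitive u\<^sub>3 u\<^sub>4"
    and z: "\<And>x. \<bar>x\<bar> > R \<Longrightarrow> u x = 0 \<and> u\<^sub>4 x = 0"
  shows "u \<in> biharmonic_dom h W"
    and "L2_norm (\<lambda>x. biharmonic_op h W u x - w * u x)
       = L2_norm (\<lambda>x. of_real (h ^ 4) * u\<^sub>4 x + W x * u x - w * u x)"
proof -
  define f where "f x = of_real (h ^ 4) * u\<^sub>4 x + W x * u x" for x
  have ul: "loc_bounded u" by (rule primitive_imp_loc_bounded[OF u(1)])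
  have u4l: "loc_bounded u\<^sub>4" by (rule primitive_loc_bounded[OF u(4)])
  have Wu: "loc_bounded (\<lambda>x. W x * u x)"
    by (intro loc_bounded_mult continuous_imp_loc_bounded W ul)
  have fl: "loc_bounded f"
    unfolding f_def by (intro loc_bounded_add loc_bounded_mult loc_bounded_const u4l Wu)
  have uL2: "u \<in> L2" using z by (intro loc_bounded_L2[OF ul, of R]) auto
  have fL2: "f \<in> L2" using z by (intro loc_bounded_L2[OF fl, of R]) (auto simp: f_def)
  note p = primitive_dist_deriv
  have d2: "dist_eq (dist_deriv (dist_deriv (regular_dist u))) (regular_dist u\<^sub>2)"
    by (rule dist_eq_trans[OF dist_eq_deriv[OF p[OF u(1)]] p[OF u(2)]])
  have d3: "dist_eq (dist_deriv (dist_deriv (dist_deriv (regular_dist u)))) (regular_dist u\<^sub>3)"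
    by (rule dist_eq_trans[OF dist_eq_deriv[OF d2] p[OF u(3)]])
  have "dist_eq (dist_deriv (dist_deriv (dist_deriv (dist_deriv (regular_dist u))))) (regular_dist u\<^sub>4)"
    by (rule dist_eq_trans[OF dist_eq_deriv[OF d3] p[OF u(4)]])
  then have d4: "dist_eq ((dist_deriv ^^ 4) (regular_dist u)) (regular_dist u\<^sub>4)"
    by (simp add: eval_nat_numeral)
  have feq: "dist_eq (biharmonic_dist h W u) (regular_dist f)"
    unfolding dist_eq_def
  proof
    fix \<phi> assume \<phi>: "\<phi> \<in> test_functions"
    obtain S where S: "loc_bounded \<phi>" "\<And>x. \<bar>x\<bar> > S \<Longrightarrow> \<phi> x = 0"
      using test_function_props[OF \<phi>] by metis
    have "integrable lebesgue (\<lambda>x. u\<^sub>4 x * \<phi> x)" "integrable lebesgue (\<lambda>x. W x * u x * \<phi> x)"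
      using integrable_loc_integrable_mult[OF loc_bounded_imp_loc_integrable[OF u4l] S]
        integrable_loc_integrable_mult[OF loc_bounded_imp_loc_integrable[OF Wu] S] by auto
    moreover have "(\<lambda>x. f x * \<phi> x) = (\<lambda>x. of_real (h ^ 4) * (u\<^sub>4 x * \<phi> x) + W x * u x * \<phi> x)"
      by (auto simp: f_def algebra_simps)
    ultimately have "(LINT x|lebesgue. f x * \<phi> x)
        = of_real (h ^ 4) * (LINT x|lebesgue. u\<^sub>4 x * \<phi> x) + (LINT x|lebesgue. W x * u x * \<phi> x)"
      by (simp del: of_real_power)
    then show "biharmonic_dist h W u \<phi> = regular_dist f \<phi>"
      using d4 \<phi> unfolding biharmonic_dist_def dist_eq_def regular_dist_def by simp
  qed
  then show "u \<in> biharmonic_dom h W"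
    using uL2 fL2 unfolding biharmonic_dom_def by blast
  define v where "v = biharmonic_op h W u"
  have v: "v \<in> L2 \<and> dist_eq (biharmonic_dist h W u) (regular_dist v)"
    unfolding v_def biharmonic_op_def by (rule someI[of _ f]) (intro conjI fL2 feq)
  have ae: "AE x in lebesgue. v x = f x"
    using v dist_eq_trans[OF dist_eq_sym feq]
    by (intro regular_dist_inj L2_loc_integrable fL2) auto
  have "v \<in> borel_measurable lebesgue" "f \<in> borel_measurable lebesgue" "u \<in> borel_measurable lebesgue"
    using v fL2 uL2 by (auto simp: L2_def)
  then have "(LINT x|lebesgue. (norm (v x - w * u x))\<^sup>2) = (LINT x|lebesgue. (norm (f x - w * u x))\<^sup>2)"
    using ae by (intro integral_cong_AE) (auto elim!: eventually_mono)
  then show "L2_norm (\<lambda>x. biharmonic_op h W u x - w * u x)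
       = L2_norm (\<lambda>x. of_real (h ^ 4) * u\<^sub>4 x + W x * u x - w * u x)"
    unfolding L2_norm_def v_def[symmetric] f_def by simp
qed

section \<open>Norm estimates\<close>

lemma L2_norm_squared: "(L2_norm u)\<^sup>2 = (LINT x|lebesgue. (norm (u x))\<^sup>2)"
  unfolding L2_norm_def by (intro real_sqrt_pow2 integral_nonneg_AE) auto

lemma L2_norm_lower_bound:
  assumes u: "loc_bounded u" "\<And>x. \<bar>x\<bar> > R \<Longrightarrow> u x = 0"
    and b: "\<And>x. s \<le> x \<Longrightarrow> x \<le> t \<Longrightarrow> b \<le> norm (u x)" and "0 \<le> b" "s \<le> t"
  shows "b\<^sup>2 * (t - s) \<le> (L2_norm u)\<^sup>2"
proof -
  have "(LINT x|lebesgue. b\<^sup>2 * indicator {s..t} x) \<le> (LINT x|lebesgue. (norm (u x))\<^sup>2)"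
  proof (rule integral_mono)
    show "integrable lebesgue (\<lambda>x. b\<^sup>2 * indicator {s..t} x)"
      by (intro integrable_mult_right) (auto simp flip: lmeasurable_iff_integrable)
    show "integrable lebesgue (\<lambda>x. (norm (u x))\<^sup>2)"
      by (rule loc_bounded_norm_power2_integrable[OF u])
    show "b\<^sup>2 * indicator {s..t} x \<le> (norm (u x))\<^sup>2" for x
      using b[of x] \<open>0 \<le> b\<close> by (auto simp: indicator_def intro: power_mono)
  qed
  then show ?thesis using \<open>s \<le> t\<close> by (simp add: L2_norm_squared)
qed

lemma L2_norm_upper_bound:
  assumes u: "loc_bounded u" "\<And>x. \<bar>x\<bar> > R \<Longrightarrow> u x = 0"
    and g: "loc_bounded g" "\<And>x. \<bar>x\<bar> > R \<Longrightarrow> g x = 0"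
    and b: "\<And>x. norm (g x) \<le> a * norm (u x) + b * indicator {s..t} x" and "s \<le> t"
  shows "(L2_norm g)\<^sup>2 \<le> 2 * a\<^sup>2 * (L2_norm u)\<^sup>2 + 2 * b\<^sup>2 * (t - s)"
proof -
  have i1: "integrable lebesgue (\<lambda>x. 2 * a\<^sup>2 * (norm (u x))\<^sup>2)"
    by (intro integrable_mult_right loc_bounded_norm_power2_integrable[OF u])
  have i2: "integrable lebesgue (\<lambda>x. 2 * b\<^sup>2 * indicator {s..t} x)"
    by (intro integrable_mult_right) (auto simp flip: lmeasurable_iff_integrable)
  have "(LINT x|lebesgue. (norm (g x))\<^sup>2)
      \<le> (LINT x|lebesgue. 2 * a\<^sup>2 * (norm (u x))\<^sup>2 + 2 * b\<^sup>2 * indicator {s..t} x)"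
  proof (rule integral_mono[OF loc_bounded_norm_power2_integrable[OF g] Bochner_Integration.integrable_add[OF i1 i2]])
    fix x
    have "(norm (g x))\<^sup>2 \<le> (a * norm (u x) + b * indicator {s..t} x)\<^sup>2"
      using b[of x] by (intro power_mono) auto
    also have "\<dots> \<le> 2 * (a * norm (u x))\<^sup>2 + 2 * (b * indicator {s..t} x)\<^sup>2"
      using zero_le_power2[of "a * norm (u x) - b * indicator {s..t} x"]
      by (simp add: power2_eq_square algebra_simps)
    also have "\<dots> = 2 * a\<^sup>2 * (norm (u x))\<^sup>2 + 2 * b\<^sup>2 * indicator {s..t} x"
      by (auto simp: indicator_def power_mult_distrib)
    finally show "(norm (g x))\<^sup>2 \<le> 2 * a\<^sup>2 * (norm (u x))\<^sup>2 + 2 * b\<^sup>2 * indicator {s..t} x" .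
  qed
  also have "\<dots> = 2 * a\<^sup>2 * (LINT x|lebesgue. (norm (u x))\<^sup>2) + 2 * b\<^sup>2 * (t - s)"
    using i1 i2 \<open>s \<le> t\<close> by simp
  finally show ?thesis by (simp add: L2_norm_squared)
qed

lemma exp_neg_inverse_le_power:
  fixes \<gamma> h :: real
  assumes "\<gamma> > 0" "h > 0" "n > 0"
  shows "exp (- (\<gamma> / h)) \<le> (real n / \<gamma>) ^ n * h ^ n"
proof -
  have "(\<gamma> / h / real n) ^ n \<le> (1 + \<gamma> / h / real n) ^ n"
    using assms by (intro power_mono) auto
  also have "\<dots> \<le> exp (\<gamma> / h)"
    using assms by (intro exp_ge_one_plus_x_over_n_power_n) (auto intro: order_trans[of _ 0])
  finally have "inverse (exp (\<gamma> / h)) \<le> inverse ((\<gamma> / h / real n) ^ n)"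
    using assms by (intro le_imp_inverse_le) auto
  then show ?thesis
    using assms by (simp add: exp_minus power_divide power_mult_distrib field_simps)
qed

lemma csqrt_right_half_plane:
  assumes "Re w > 0"
  shows "Re (csqrt w) > 0" "Im w > 0 \<Longrightarrow> Im (csqrt w) > 0" "Im w < 0 \<Longrightarrow> Im (csqrt w) < 0"
proof -
  show "Re (csqrt w) > 0" using assms by (simp add: add_nonneg_pos)
  have "cmod w > Re w" if "Im w \<noteq> 0"
  proof -
    have "(Re w)\<^sup>2 < (cmod w)\<^sup>2" using that by (simp add: cmod_power2)
    then show ?thesis using power2_less_imp_less norm_ge_zero by blast
  qed
  then show "Im w > 0 \<Longrightarrow> Im (csqrt w) > 0" "Im w < 0 \<Longrightarrow> Im (csqrt w) < 0"
    by (auto simp: mult_neg_pos)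
qed

section \<open>Construction of the quasimode\<close>

text \<open>The terms of the Leibniz expansion in which the cutoff has been differentiated. Only boundedness uniformly
in \<open>h\<close> matters, since they get multiplied by an exponentially small factor.\<close>
lemma wkb_cutoff_estimate:
  assumes "norm a\<^sub>0 \<le> K" "norm a\<^sub>1 \<le> K" "norm a\<^sub>2 \<le> K"
    and "norm f\<^sub>1 \<le> L" "norm f\<^sub>2 \<le> L" "norm f\<^sub>3 \<le> L" "norm f\<^sub>4 \<le> L"
    and "1 \<le> K" "0 < h" "h \<le> 1"
  shows "norm (4 * of_real h * f\<^sub>1 * (a\<^sub>0 ^ 3 + 3 * a\<^sub>0 * a\<^sub>1 + a\<^sub>2) + 6 * of_real h ^ 2 * f\<^sub>2 * (a\<^sub>0\<^sup>2 + a\<^sub>1)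
      + 4 * of_real h ^ 3 * f\<^sub>3 * a\<^sub>0 + of_real h ^ 4 * f\<^sub>4 :: complex) \<le> 37 * L * K ^ 3"
proof -
  have K: "K \<le> K ^ 3" "K ^ 2 \<le> K ^ 3" "1 \<le> K ^ 3"
    using \<open>1 \<le> K\<close> power_increasing[of 1 3 K] power_increasing[of 2 3 K] one_le_power[of K 3] by auto
  have L: "0 \<le> L" using assms(4) norm_ge_zero order_trans by blast
  have h: "norm (of_real h ^ n :: complex) \<le> 1" for n
    using assms(9,10) by (simp add: norm_power power_le_one)
  have h1: "norm (of_real h :: complex) \<le> 1" using h[of 1] by simp
  have p2: "norm (a\<^sub>0\<^sup>2) \<le> K ^ 2" "norm (a\<^sub>0 ^ 3) \<le> K ^ 3" "norm (a\<^sub>0 * a\<^sub>1) \<le> K * K"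
    using assms by (auto simp: norm_power norm_mult intro!: power_mono mult_mono)
  have P2: "norm (a\<^sub>0\<^sup>2 + a\<^sub>1) \<le> 2 * K ^ 3"
    using norm_triangle_ineq[of "a\<^sub>0\<^sup>2" a\<^sub>1] p2 assms(2) K by linarith
  have P3: "norm (a\<^sub>0 ^ 3 + 3 * a\<^sub>0 * a\<^sub>1 + a\<^sub>2) \<le> 5 * K ^ 3"
  proof -
    have "norm (a\<^sub>0 ^ 3 + 3 * a\<^sub>0 * a\<^sub>1 + a\<^sub>2) \<le> norm (a\<^sub>0 ^ 3) + norm (3 * a\<^sub>0 * a\<^sub>1) + norm a\<^sub>2"
      by (intro norm_triangle_mono order_refl)
    also have "norm (3 * a\<^sub>0 * a\<^sub>1) = 3 * norm (a\<^sub>0 * a\<^sub>1)" by (simp add: norm_mult)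
    finally show ?thesis using p2 assms(3) K by (simp add: power2_eq_square)
  qed
  have 1: "norm (4 * of_real h * f\<^sub>1 * (a\<^sub>0 ^ 3 + 3 * a\<^sub>0 * a\<^sub>1 + a\<^sub>2)) \<le> 4 * 1 * L * (5 * K ^ 3)"
    unfolding norm_mult by (intro mult_mono P3 assms h1) (use L assms in auto)
  have 2: "norm (6 * of_real h ^ 2 * f\<^sub>2 * (a\<^sub>0\<^sup>2 + a\<^sub>1)) \<le> 6 * 1 * L * (2 * K ^ 3)"
    unfolding norm_mult by (intro mult_mono P2 assms h) (use L assms in auto)
  have 3: "norm (4 * of_real h ^ 3 * f\<^sub>3 * a\<^sub>0) \<le> 4 * 1 * L * K ^ 3"
    unfolding norm_mult using assms(1) K(1)
    by (intro mult_mono assms h) (use L assms in auto)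
  have 4: "norm (of_real h ^ 4 * f\<^sub>4) \<le> 1 * L * K ^ 3"
  proof -
    have "norm (of_real h ^ 4 * f\<^sub>4) \<le> 1 * L"
      unfolding norm_mult by (intro mult_mono assms h) (use L in auto)
    also have "\<dots> \<le> 1 * L * K ^ 3" using K(3) L mult_left_mono[of 1 "K ^ 3" L] by simp
    finally show ?thesis .
  qed
  show ?thesis
    by (rule order_trans[OF norm_triangle_mono[OF norm_triangle_mono[OF norm_triangle_mono[OF 1 2] 3] 4]])
      simp
qed

text \<open>The real part of \<open>C\<close> increases up to \<open>x\<^sub>0\<close> and decreases afterwards, so it is negative away from \<open>x\<^sub>0\<close>.
Compactness makes this uniform. There is no rate, as the order of vanishing of \<open>c\<close>'s real part at \<open>x\<^sub>0\<close> is
arbitrary.\<close>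
lemma primitive_of_sign_changing_negative:
  assumes C: "primitive C c" "C x\<^sub>0 = 0" and c: "continuous_on UNIV c" and d: "0 < d"
    and l: "\<And>x. x\<^sub>0 - \<delta> \<le> x \<Longrightarrow> x < x\<^sub>0 \<Longrightarrow> Re (c x) > 0"
    and r: "\<And>x. x\<^sub>0 < x \<Longrightarrow> x \<le> x\<^sub>0 + \<delta> \<Longrightarrow> Re (c x) < 0"
  obtains \<gamma> where "\<gamma> > 0" "\<And>x. d \<le> \<bar>x - x\<^sub>0\<bar> \<Longrightarrow> \<bar>x - x\<^sub>0\<bar> \<le> \<delta> \<Longrightarrow> Re (C x) \<le> - \<gamma>"
proof -
  have der: "((\<lambda>x. Re (C x)) has_real_derivative Re (c x)) (at x)" for x
    using bounded_linear.has_vector_derivative[OF bounded_linear_Re primitive_has_derivative[OF C(1) c]]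
    by (simp add: has_real_derivative_iff_has_vector_derivative)
  have cont: "continuous_on S (\<lambda>x. Re (C x))" for S
    by (intro continuous_intros continuous_on_subset[OF primitive_continuous[OF C(1)]]) auto
  have neg: "Re (C x) < 0" if "x \<noteq> x\<^sub>0" "\<bar>x - x\<^sub>0\<bar> \<le> \<delta>" for x
  proof (cases "x < x\<^sub>0")
    case True
    have "Re (C x) < Re (C x\<^sub>0)"
    proof (rule DERIV_pos_imp_increasing_open[OF True _ cont])
      show "\<exists>y'. ((\<lambda>x. Re (C x)) has_real_derivative y') (at y) \<and> 0 < y'" if "x < y" "y < x\<^sub>0" for y
        using der[of y] l[of y] that \<open>\<bar>x - x\<^sub>0\<bar> \<le> \<delta>\<close> by auto
    qed
    then show ?thesis using C(2) by simp
  next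
    case False
    then have "x\<^sub>0 < x" using that by simp
    then have "Re (C x) < Re (C x\<^sub>0)"
    proof (rule DERIV_neg_imp_decreasing_open[OF _ _ cont])
      show "\<exists>y'. ((\<lambda>x. Re (C x)) has_real_derivative y') (at y) \<and> y' < 0" if "x\<^sub>0 < y" "y < x" for y
        using der[of y] r[of y] that \<open>\<bar>x - x\<^sub>0\<bar> \<le> \<delta>\<close> by auto
    qed
    then show ?thesis using C(2) by simp
  qed
  define S where "S = {x\<^sub>0 - \<delta>..x\<^sub>0 - d} \<union> {x\<^sub>0 + d..x\<^sub>0 + \<delta>}"
  have S: "x \<in> S" if "d \<le> \<bar>x - x\<^sub>0\<bar>" "\<bar>x - x\<^sub>0\<bar> \<le> \<delta>" for x
    using that by (cases "x < x\<^sub>0") (auto simp: S_def)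
  show ?thesis
  proof (cases "S = {}")
    case True
    then show ?thesis using S by (intro that[of 1]) auto
  next
    case False
    have "compact S" unfolding S_def by (intro compact_Un compact_Icc)
    then obtain y where y: "y \<in> S" "\<And>x. x \<in> S \<Longrightarrow> Re (C x) \<le> Re (C y)"
      using continuous_attains_sup[OF _ False cont] by blast
    then have "Re (C y) < 0" using d by (intro neg) (auto simp: S_def)
    then show ?thesis using y S by (intro that[of "- Re (C y)"]) auto
  qed
qed

lemma primitive_bound_from_zero:
  assumes p: "primitive f g" "f x\<^sub>0 = 0" and b: "\<And>t. \<bar>t - x\<^sub>0\<bar> \<le> \<bar>x - x\<^sub>0\<bar> \<Longrightarrow> norm (g t) \<le> B"
  shows "norm (f x) \<le> B * \<bar>x - x\<^sub>0\<bar>"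
proof -
  have "0 \<le> B" using b[of x\<^sub>0] norm_ge_zero[of "g x\<^sub>0"] by linarith
  show ?thesis
  proof (cases "x\<^sub>0 \<le> x")
    case True
    have "norm (f x - f x\<^sub>0) \<le> B * (x - x\<^sub>0)"
      by (rule has_integral_bound_interval[OF primitiveD[OF p(1) True] True \<open>0 \<le> B\<close>])
        (use True in \<open>auto intro!: b\<close>)
    then show ?thesis using p(2) True by simp
  next
    case False
    then have le: "x \<le> x\<^sub>0" by simp
    have "norm (f x\<^sub>0 - f x) \<le> B * (x\<^sub>0 - x)"
      by (rule has_integral_bound_interval[OF primitiveD[OF p(1) le] le \<open>0 \<le> B\<close>])
        (use le in \<open>auto intro!: b\<close>)
    then show ?thesis using p(2) le by simp
  qed
qed

text \<open>The second term of the bound on \<open>\<rho>\<^sup>2\<close> carries a factor \<open>h\<^sup>2\<close>, one power of which is absorbed by the lower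
bound \<open>2 h \<le> E \<nu>\<^sup>2\<close>.\<close>
lemma quotient_estimate:
  fixes \<rho> \<nu> X h E :: real
  assumes \<rho>: "\<rho>\<^sup>2 \<le> 2 * (M * X)\<^sup>2 * \<nu>\<^sup>2 + 2 * (B * (X * h))\<^sup>2 * (2 * \<delta>)" and lo: "2 * h \<le> E * \<nu>\<^sup>2"
    and h: "0 < h" "h \<le> 1" and \<nu>: "0 < \<nu>" and X: "0 \<le> X" and \<delta>: "0 < \<delta>"
  shows "\<rho> / \<nu> \<le> sqrt (2 * M\<^sup>2 + 2 * \<delta> * B\<^sup>2 * E) * X"
proof -
  define D where "D = 2 * M\<^sup>2 + 2 * \<delta> * B\<^sup>2 * E"
  have "0 < E * \<nu>\<^sup>2" using lo h(1) by linarith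
  then have "0 \<le> E" using \<nu> by (simp add: zero_less_mult_iff)
  then have D: "0 \<le> D" unfolding D_def using \<delta> by auto
  have "2 * h * h \<le> 2 * h" using h by (simp add: mult_le_cancel_left1)
  then have "2 * h * h \<le> E * \<nu>\<^sup>2" using lo by linarith
  then have "2 * \<delta> * B\<^sup>2 * X\<^sup>2 * (2 * h * h) \<le> 2 * \<delta> * B\<^sup>2 * X\<^sup>2 * (E * \<nu>\<^sup>2)"
    using \<delta> by (intro mult_left_mono) auto
  moreover have "2 * (B * (X * h))\<^sup>2 * (2 * \<delta>) = 2 * \<delta> * B\<^sup>2 * X\<^sup>2 * (2 * h * h)"
    by algebra
  moreover have "2 * (M * X)\<^sup>2 * \<nu>\<^sup>2 + 2 * \<delta> * B\<^sup>2 * X\<^sup>2 * (E * \<nu>\<^sup>2) = D * X\<^sup>2 * \<nu>\<^sup>2"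
    unfolding D_def by algebra
  moreover have "(sqrt D * X * \<nu>)\<^sup>2 = D * X\<^sup>2 * \<nu>\<^sup>2"
    using D by (simp add: power_mult_distrib)
  ultimately have "\<rho>\<^sup>2 \<le> (sqrt D * X * \<nu>)\<^sup>2"
    using \<rho> by linarith
  then have "\<rho> \<le> sqrt D * X * \<nu>"
    by (rule power2_le_imp_le) (use D X \<nu> in auto)
  then show ?thesis using \<nu> by (simp add: divide_le_eq D_def)
qed

text \<open>Let \<open>\<phi>' = a\<^sub>0 / h\<close> with the formal solution \<open>a\<^sub>0\<close>; the factor \<open>1 / h\<close> is thus part of \<open>\<phi>\<close>. The residual has
two parts. One is \<open>O(h^(N + 1))\<close> times \<open>\<Psi>\<close> itself by the choice of \<open>a\<^sub>0\<close>. The other contains derivatives of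
the cutoff, lives in \<open>\<delta> / 2 \<le> \<bar>x - x\<^sub>0\<bar> \<le> \<delta>\<close>, and is bounded by a multiple of \<open>exp (- \<gamma> / h)\<close>.
Since \<open>a\<^sub>0\<close> is bounded, \<open>\<phi>\<close> is bounded on \<open>\<bar>x - x\<^sub>0\<bar> \<le> h\<close>, which gives the lower bound of the norm.\<close>
theorem quasimode_of_root:
  fixes c q W :: "real \<Rightarrow> complex"
  assumes W: "continuous_on UNIV W"
    and q: "sobolev (N + 3) q" and c: "sobolev (N + 3) c" "sobolev (N + 3) (\<lambda>x. inverse (c x))"
    and c4: "\<And>x. c x ^ 4 = q x" and nz: "\<And>x. c x \<noteq> 0"
    and \<delta>: "\<delta> > 0" and qW: "\<And>x. \<bar>x - x\<^sub>0\<bar> \<le> \<delta> \<Longrightarrow> q x = z - W x"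
    and left: "\<And>x. x\<^sub>0 - \<delta> \<le> x \<Longrightarrow> x < x\<^sub>0 \<Longrightarrow> Re (c x) > 0"
    and right: "\<And>x. x\<^sub>0 < x \<Longrightarrow> x \<le> x\<^sub>0 + \<delta> \<Longrightarrow> Re (c x) < 0"
  shows "\<exists>h\<^sub>0>0. \<exists>\<Psi> :: real \<Rightarrow> real \<Rightarrow> complex. \<exists>C::real. \<forall>h\<in>{0<..<h\<^sub>0}.
    \<Psi> h \<in> biharmonic_dom h W \<and> L2_norm (\<Psi> h) \<noteq> 0 \<and>
    L2_norm (\<lambda>x. biharmonic_op h W (\<Psi> h) x - z * \<Psi> h x) / L2_norm (\<Psi> h) \<le> C * h ^ (N + 1)"
proof -
  define R where "R = \<bar>x\<^sub>0\<bar> + \<delta>"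
  obtain A0 A1 A2 A3 where
    G: "graded (N + 3) A0" "graded (N + 3) A1" "graded (N + 3) A2" "graded (N + 3) A3"
    and D: "scaled_primitive A0 A1" "scaled_primitive A1 A2" "scaled_primitive A2 A3"
    and A00: "\<And>x. coeff (A0 x) 0 = c x"
    and ric: "\<And>x j. j \<le> N \<Longrightarrow> coeff (riccati (A0 x) (A1 x) (A2 x) (A3 x) - [:q x:]) j = 0"
    using formal_wkb_solution[OF q c c4 nz order_refl] by metis
  define a where "a A h x = poly (A x) (complex_of_real h)" for A :: "real \<Rightarrow> complex poly" and h x
  have ap: "primitive (a A h) (\<lambda>x. a A' h x / of_real h)" if "scaled_primitive A A'" "h > 0" for A A' h
    using that unfolding scaled_primitive_def a_def by auto
  obtain \<eta>' :: "real \<Rightarrow> real" where \<eta>': "\<And>k. sobolev k (\<lambda>x. of_real (\<eta>' x))"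
    "\<And>x. \<bar>x - x\<^sub>0\<bar> \<le> \<delta> / 2 \<Longrightarrow> \<eta>' x = 1" "\<And>x. \<bar>x - x\<^sub>0\<bar> \<ge> \<delta> \<Longrightarrow> \<eta>' x = 0"
  proof -
    have "0 < \<delta> / 2" "\<delta> / 2 < \<delta>" using \<delta> by auto
    then show ?thesis by (rule smooth_cutoff) (rule that)
  qed
  define \<eta> where "\<eta> x = complex_of_real (\<eta>' x)" for x
  define S where "S = {x. \<bar>x - x\<^sub>0\<bar> < \<delta> / 2} \<union> {x. \<bar>x - x\<^sub>0\<bar> > \<delta>}"
  have opens: "open {x. \<bar>x - x\<^sub>0\<bar> < \<delta> / 2}" "open {x. \<bar>x - x\<^sub>0\<bar> > \<delta>}"
    by (intro open_Collect_less continuous_intros)+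
  have Sopen: "open S"
    unfolding S_def by (intro open_Un opens)
  have const: "\<exists>T c. open T \<and> x \<in> T \<and> (\<forall>y\<in>T. \<eta> y = c)" if "x \<in> S" for x
  proof (cases "\<bar>x - x\<^sub>0\<bar> < \<delta> / 2")
    case True
    then show ?thesis using opens(1) \<eta>'(2)
      by (intro exI[of _ "{x. \<bar>x - x\<^sub>0\<bar> < \<delta> / 2}"] exI[of _ 1]) (auto simp: \<eta>_def)
  next
    case False
    then show ?thesis using that opens(2) \<eta>'(3)
      by (intro exI[of _ "{x. \<bar>x - x\<^sub>0\<bar> > \<delta>}"] exI[of _ 0]) (auto simp: \<eta>_def S_def)
  qed
  have \<eta>s: "sobolev k \<eta>" for k using \<eta>'(1) by (simp add: \<eta>_def[abs_def])
  obtain f1 f2 f3 f4 where f: "primitive \<eta> f1" "primitive f1 f2" "primitive f2 f3" "primitive f3 f4"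
    and fz: "\<And>x. x \<in> S \<Longrightarrow> f1 x = 0 \<and> f2 x = 0 \<and> f3 x = 0 \<and> f4 x = 0"
    using smooth_four_derivatives[OF \<eta>s Sopen const] by metis
  have "\<exists>L. L > 0 \<and> (\<forall>x. \<bar>x\<bar> \<le> R \<longrightarrow> norm (g x) \<le> L)" if "loc_bounded g" for g
    using loc_bounded_bound[OF that] by metis
  note this[OF primitive_loc_bounded[OF f(1)]] this[OF primitive_loc_bounded[OF f(2)]]
    this[OF primitive_loc_bounded[OF f(3)]] this[OF primitive_loc_bounded[OF f(4)]]
  then obtain L1 L2 L3 L4 where
    "L1 > 0" "\<And>x. \<bar>x\<bar> \<le> R \<Longrightarrow> norm (f1 x) \<le> L1" "L2 > 0" "\<And>x. \<bar>x\<bar> \<le> R \<Longrightarrow> norm (f2 x) \<le> L2"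
    "L3 > 0" "\<And>x. \<bar>x\<bar> \<le> R \<Longrightarrow> norm (f3 x) \<le> L3" "L4 > 0" "\<And>x. \<bar>x\<bar> \<le> R \<Longrightarrow> norm (f4 x) \<le> L4"
    by blast
  then obtain L where L: "L > 0" "\<And>x. \<bar>x\<bar> \<le> R \<Longrightarrow> norm (f1 x) \<le> L" "\<And>x. \<bar>x\<bar> \<le> R \<Longrightarrow> norm (f2 x) \<le> L"
    "\<And>x. \<bar>x\<bar> \<le> R \<Longrightarrow> norm (f3 x) \<le> L" "\<And>x. \<bar>x\<bar> \<le> R \<Longrightarrow> norm (f4 x) \<le> L"
    by (intro that[of "L1 + L2 + L3 + L4"]) (fastforce intro: add_pos_pos)+
  have bnd: "\<exists>K. K > 0 \<and> (\<forall>x h. \<bar>x\<bar> \<le> R \<longrightarrow> 0 < h \<longrightarrow> h \<le> 1 \<longrightarrow> norm (a A h x) \<le> K * h ^ s)"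
    if "graded (N + 3) A" "\<And>x j. j < s \<Longrightarrow> coeff (A x) j = 0" for A s
    using graded_eval_bound[OF that, where R = R] unfolding a_def by metis
  obtain K0 where K0: "K0 > 0" "\<And>x h. \<bar>x\<bar> \<le> R \<Longrightarrow> 0 < h \<Longrightarrow> h \<le> 1 \<Longrightarrow> norm (a A0 h x) \<le> K0 * h ^ 0"
    using bnd[OF G(1), of 0] by auto
  obtain K1 where K1: "K1 > 0" "\<And>x h. \<bar>x\<bar> \<le> R \<Longrightarrow> 0 < h \<Longrightarrow> h \<le> 1 \<Longrightarrow> norm (a A1 h x) \<le> K1 * h ^ 0"
    using bnd[OF G(2), of 0] by auto
  obtain K2 where K2: "K2 > 0" "\<And>x h. \<bar>x\<bar> \<le> R \<Longrightarrow> 0 < h \<Longrightarrow> h \<le> 1 \<Longrightarrow> norm (a A2 h x) \<le> K2 * h ^ 0"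
    using bnd[OF G(3), of 0] by auto
  define K where "K = K0 + K1 + K2 + 1"
  have K: "1 \<le> K" "\<And>x h. \<bar>x\<bar> \<le> R \<Longrightarrow> 0 < h \<Longrightarrow> h \<le> 1 \<Longrightarrow>
      norm (a A0 h x) \<le> K \<and> norm (a A1 h x) \<le> K \<and> norm (a A2 h x) \<le> K"
    using K0 K1 K2 unfolding K_def by (simp, fastforce)
  have gc: "graded (N + 3) (\<lambda>x. [:c x:])"
    using graded_monom[of "N + 3" 0 c] c(1) by (simp add: monom_0)
  have gq: "graded (N + 3) (\<lambda>x. [:q x:])"
    using graded_monom[of "N + 3" 0 q] q by (simp add: monom_0)
  obtain M1 where M1: "M1 > 0"
    "\<And>x h. \<bar>x\<bar> \<le> R \<Longrightarrow> 0 < h \<Longrightarrow> h \<le> 1 \<Longrightarrow> norm (a A0 h x - c x) \<le> M1 * h"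
    using bnd[OF graded_diff[OF G(1) gc], of 1] A00 by (auto simp: a_def)
  obtain M2 where M2: "M2 > 0" "\<And>x h. \<bar>x\<bar> \<le> R \<Longrightarrow> 0 < h \<Longrightarrow> h \<le> 1 \<Longrightarrow>
      norm (riccati (a A0 h x) (a A1 h x) (a A2 h x) (a A3 h x) - q x) \<le> M2 * h ^ (N + 1)"
  proof -
    have "poly (riccati p0 p1 p2 p3 - [:w:]) y
        = riccati (poly p0 y) (poly p1 y) (poly p2 y) (poly p3 y) - w" for p0 p1 p2 p3 and w y :: complex
      by (simp add: riccati_def)
    then show ?thesis
      using bnd[OF graded_diff[OF graded_riccati[OF G] gq], of "N + 1"] ric that
      by (auto simp: a_def less_Suc_eq_le simp del: power_Suc)
  qed
  \<comment> \<open>the leading part of \<open>h \<phi>\<close>, independent of \<open>h\<close>\<close>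
  obtain Cc where Cc: "primitive Cc c" "Cc x\<^sub>0 = 0"
    using primitive_integral[OF sobolev_loc_bounded[OF c(1)]] by metis
  obtain \<gamma> where \<gamma>: "\<gamma> > 0"
    "\<And>x. \<delta> / 2 \<le> \<bar>x - x\<^sub>0\<bar> \<Longrightarrow> \<bar>x - x\<^sub>0\<bar> \<le> \<delta> \<Longrightarrow> Re (Cc x) \<le> - \<gamma>"
  proof (rule primitive_of_sign_changing_negative[OF Cc, of "\<delta> / 2" \<delta>])
    show "continuous_on UNIV c" by (rule sobolev_continuous[OF c(1)]) simp
  qed (use \<delta> left right in auto)
  have "\<forall>h. \<exists>\<phi>. h > 0 \<longrightarrow> primitive \<phi> (\<lambda>x. a A0 h x / of_real h) \<and> \<phi> x\<^sub>0 = 0"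
    using primitive_integral[OF loc_bounded_divide_const[OF primitive_imp_loc_bounded[OF ap[OF D(1)]]]]
    by blast
  then obtain \<phi> where \<phi>: "\<And>h. h > 0 \<Longrightarrow> primitive (\<phi> h) (\<lambda>x. a A0 h x / of_real h)"
    "\<And>h. h > 0 \<Longrightarrow> \<phi> h x\<^sub>0 = 0" by metis
  define e where "e h x = exp (\<phi> h x)" for h x
  define \<Psi> where "\<Psi> h x = \<eta> x * e h x" for h x
  define n where "n = N + 2"
  \<comment> \<open>the bound of the differentiated-cutoff terms, with \<open>exp (- \<gamma> / h)\<close> estimated by a power \<open>h^(N + 2)\<close>\<close>
  define B where "B = 37 * L * K ^ 3 * exp (M1 * \<delta>) * (real n / \<gamma>) ^ n"
  define C where "C = sqrt (2 * M2\<^sup>2 + 2 * \<delta> * B\<^sup>2 * exp (2 * K))"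
  have B0: "B \<ge> 0" unfolding B_def using L K \<gamma> by auto
  define h\<^sub>0 where "h\<^sub>0 = min 1 (\<delta> / 2)"
  have main: "\<Psi> h \<in> biharmonic_dom h W \<and> L2_norm (\<Psi> h) \<noteq> 0 \<and>
    L2_norm (\<lambda>x. biharmonic_op h W (\<Psi> h) x - z * \<Psi> h x) / L2_norm (\<Psi> h) \<le> C * h ^ (N + 1)"
    if "h \<in> {0<..<h\<^sub>0}" for h
  proof -
    have h: "0 < h" "h \<le> 1" "h \<le> \<delta> / 2" using that by (auto simp: h\<^sub>0_def)
    define H where "H = complex_of_real h"
    have H0: "H \<noteq> 0" using h by (simp add: H_def)
    note pr = ap[OF D(1) h(1), folded H_def] ap[OF D(2) h(1), folded H_def] ap[OF D(3) h(1), folded H_def]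
    have cont: "continuous_on UNIV (\<lambda>x. a A0 h x / H)"
      using H0 by (intro continuous_intros primitive_continuous[OF pr(1)]) simp
    have ep: "primitive (e h) (\<lambda>x. a A0 h x * e h x / H)"
      using primitive_exp[OF \<phi>(1)[OF h(1), folded H_def] cont] by (simp add: e_def[abs_def])
    note et = exponential_derivatives[OF pr ep H0]
    define g1 where "g1 x = a A0 h x * e h x / H" for x
    define g2 where "g2 x = (a A0 h x ^ 2 + a A1 h x) * e h x / H ^ 2" for x
    define g3 where "g3 x = (a A0 h x ^ 3 + 3 * a A0 h x * a A1 h x + a A2 h x) * e h x / H ^ 3" for x
    define g4 where "g4 x = riccati (a A0 h x) (a A1 h x) (a A2 h x) (a A3 h x) * e h x / H ^ 4" for x
    have g: "primitive (e h) g1" "primitive g1 g2" "primitive g2 g3" "primitive g3 g4"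
      unfolding g1_def[abs_def] g2_def[abs_def] g3_def[abs_def] g4_def[abs_def]
      by (rule ep, rule et(1), rule et(2), rule et(3))
    define u4 where
      "u4 x = \<eta> x * g4 x + 4 * f1 x * g3 x + 6 * f2 x * g2 x + 4 * f3 x * g1 x + f4 x * e h x" for x
    obtain u1 u2 u3 where u: "primitive (\<Psi> h) u1" "primitive u1 u2" "primitive u2 u3" "primitive u3 u4"
      unfolding u4_def[abs_def] \<Psi>_def[abs_def] by (rule fourth_derivative_product[OF f g])
    have off: "\<Psi> h x = 0 \<and> u4 x = 0" if "\<bar>x - x\<^sub>0\<bar> > \<delta>" for x
      using \<eta>'(3)[of x] fz[of x] that by (simp add: \<Psi>_def u4_def S_def \<eta>_def)
    have offR: "\<Psi> h x = 0 \<and> u4 x = 0" if "\<bar>x\<bar> > R" for x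
      using that by (intro off) (auto simp: R_def)
    note op = biharmonic_op_compact_support[OF W u offR, where h = h]
    \<comment> \<open>the residual, up to a null set\<close>
    define r where "r x = of_real (h ^ 4) * u4 x + W x * \<Psi> h x - z * \<Psi> h x" for x
    have opr: "L2_norm (\<lambda>x. biharmonic_op h W (\<Psi> h) x - z * \<Psi> h x) = L2_norm r"
      using op(2)[where w = z] by (simp only: r_def[abs_def])
    have \<Psi>l: "loc_bounded (\<Psi> h)" by (rule primitive_imp_loc_bounded[OF u(1)])
    have rl: "loc_bounded r"
      unfolding r_def by (intro loc_bounded_diff loc_bounded_add loc_bounded_mult loc_bounded_const
          primitive_loc_bounded[OF u(4)] \<Psi>l continuous_imp_loc_bounded W)
    have r0: "r x = 0" if "\<bar>x\<bar> > R" for x using offR[OF that] by (simp add: r_def)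
    have inR: "\<bar>x\<bar> \<le> R" if "\<bar>x - x\<^sub>0\<bar> \<le> \<delta>" for x using that by (auto simp: R_def)
    \<comment> \<open>the exponent is an integral of \<open>a\<^sub>0 / h\<close> over a length of at most \<open>h\<close>\<close>
    have low: "exp (- K) \<le> norm (\<Psi> h x)" if x: "x\<^sub>0 - h \<le> x" "x \<le> x\<^sub>0 + h" for x
    proof -
      have xh: "\<bar>x - x\<^sub>0\<bar> \<le> h" using x by auto
      have "norm (\<phi> h x) \<le> K / h * \<bar>x - x\<^sub>0\<bar>"
      proof (rule primitive_bound_from_zero[OF \<phi>[OF h(1)]])
        fix t assume "\<bar>t - x\<^sub>0\<bar> \<le> \<bar>x - x\<^sub>0\<bar>"
        then have "norm (a A0 h t) \<le> K" using K(2)[OF inR h(1,2), of t] xh h by simp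
        then show "norm (a A0 h t / of_real h) \<le> K / h"
          using h by (simp add: norm_divide divide_right_mono)
      qed
      also have "\<dots> \<le> K / h * h" using xh K h by (intro mult_left_mono) auto
      finally have "\<bar>Re (\<phi> h x)\<bar> \<le> K" using abs_Re_le_cmod[of "\<phi> h x"] h by simp
      moreover have "\<eta> x = 1" using \<eta>'(2)[of x] xh h by (simp add: \<eta>_def)
      ultimately show ?thesis by (simp add: \<Psi>_def e_def)
    qed
    have small: "norm (e h x) \<le> exp (M1 * \<delta>) * ((real n / \<gamma>) ^ n * h ^ n)"
      if x: "\<delta> / 2 \<le> \<bar>x - x\<^sub>0\<bar>" "\<bar>x - x\<^sub>0\<bar> \<le> \<delta>" for x
    proof -
      \<comment> \<open>the correction \<open>a\<^sub>0 - c = O(h)\<close> changes the exponent only by a bounded amount\<close>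
      have "primitive (\<lambda>x. \<phi> h x - Cc x / H) (\<lambda>x. a A0 h x / H - c x / H)"
        using primitive_add[OF \<phi>(1)[OF h(1)] primitive_cmult[OF Cc(1), of "- 1 / H"]]
        by (simp add: H_def)
      moreover have "\<phi> h x\<^sub>0 - Cc x\<^sub>0 / H = 0" using \<phi>(2)[OF h(1)] Cc(2) by simp
      ultimately have "norm (\<phi> h x - Cc x / H) \<le> M1 * \<bar>x - x\<^sub>0\<bar>"
      proof (rule primitive_bound_from_zero)
        fix t assume "\<bar>t - x\<^sub>0\<bar> \<le> \<bar>x - x\<^sub>0\<bar>"
        then have "norm (a A0 h t - c t) \<le> M1 * h" using M1(2)[OF inR h(1,2), of t] x by simp
        then show "norm (a A0 h t / H - c t / H) \<le> M1"
          using h by (simp add: H_def norm_divide divide_le_eq flip: diff_divide_distrib)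
      qed
      also have "\<dots> \<le> M1 * \<delta>" using M1 x by (intro mult_left_mono) auto
      finally have "Re (\<phi> h x) - Re (Cc x) / h \<le> M1 * \<delta>"
        using complex_Re_le_cmod[of "\<phi> h x - Cc x / H"] by (simp add: H_def)
      moreover have "Re (Cc x) / h \<le> - (\<gamma> / h)"
        using divide_right_mono[OF \<gamma>(2)[OF x], of h] h by simp
      ultimately have "norm (e h x) \<le> exp (M1 * \<delta> + - (\<gamma> / h))" by (simp add: e_def)
      also have "\<dots> \<le> exp (M1 * \<delta>) * ((real n / \<gamma>) ^ n * h ^ n)"
        unfolding exp_add using exp_neg_inverse_le_power[OF \<gamma>(1) h(1), of n]
        by (intro mult_left_mono) (auto simp: n_def)
      finally show ?thesis .
    qed
    have res: "norm (r x) \<le> (M2 * h ^ (N + 1)) * norm (\<Psi> h x) + (B * h ^ n) * indicator {x\<^sub>0 - \<delta>..x\<^sub>0 + \<delta>} x" for x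
    proof (cases "\<bar>x - x\<^sub>0\<bar> \<le> \<delta>")
      case False
      then have "r x = 0" using off[of x] by (simp add: r_def)
      then show ?thesis using M2 h B0 by simp
    next
      case True
      then have ind: "indicator {x\<^sub>0 - \<delta>..x\<^sub>0 + \<delta>} x = (1::real)"
        by (auto simp: indicator_def)
      define rem where "rem = 4 * H * f1 x * (a A0 h x ^ 3 + 3 * a A0 h x * a A1 h x + a A2 h x)
        + 6 * H ^ 2 * f2 x * ((a A0 h x)\<^sup>2 + a A1 h x) + 4 * H ^ 3 * f3 x * a A0 h x + H ^ 4 * f4 x"
      have req: "r x = (riccati (a A0 h x) (a A1 h x) (a A2 h x) (a A3 h x) - q x) * \<Psi> h x + rem * e h x"
      proof -
        have "H ^ 4 * g4 x = riccati (a A0 h x) (a A1 h x) (a A2 h x) (a A3 h x) * e h x"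
          "H ^ 4 * g3 x = H * (a A0 h x ^ 3 + 3 * a A0 h x * a A1 h x + a A2 h x) * e h x"
          "H ^ 4 * g2 x = H ^ 2 * ((a A0 h x)\<^sup>2 + a A1 h x) * e h x"
          "H ^ 4 * g1 x = H ^ 3 * a A0 h x * e h x"
          unfolding g1_def g2_def g3_def g4_def using H0 by (simp_all add: eval_nat_numeral)
        note gg = this
        have "H ^ 4 * u4 x = \<eta> x * (H ^ 4 * g4 x) + 4 * f1 x * (H ^ 4 * g3 x) + 6 * f2 x * (H ^ 4 * g2 x)
          + 4 * f3 x * (H ^ 4 * g1 x) + H ^ 4 * f4 x * e h x"
          unfolding u4_def by (simp add: algebra_simps)
        also have "\<dots> = riccati (a A0 h x) (a A1 h x) (a A2 h x) (a A3 h x) * \<Psi> h x + rem * e h x"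
          unfolding gg rem_def \<Psi>_def by (simp add: algebra_simps)
        finally show ?thesis
          unfolding r_def qW[OF True] by (simp add: H_def algebra_simps)
      qed
      have "norm (rem * e h x) \<le> B * h ^ n"
      proof (cases "\<bar>x - x\<^sub>0\<bar> < \<delta> / 2")
        case True
        then have "rem = 0" using fz[of x] by (simp add: rem_def S_def)
        then show ?thesis using B0 h by simp
      next
        case False
        have "norm rem \<le> 37 * L * K ^ 3"
          unfolding rem_def H_def using K(2)[OF inR[OF True] h(1,2)] L(2-)[OF inR[OF True]] K(1) h
          by (intro wkb_cutoff_estimate) auto
        then have "norm (rem * e h x) \<le> (37 * L * K ^ 3) * (exp (M1 * \<delta>) * ((real n / \<gamma>) ^ n * h ^ n))"
          unfolding norm_mult using small[of x] False True L K by (intro mult_mono) auto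
        then show ?thesis by (simp add: B_def mult.assoc)
      qed
      moreover have "norm ((riccati (a A0 h x) (a A1 h x) (a A2 h x) (a A3 h x) - q x) * \<Psi> h x)
          \<le> M2 * h ^ (N + 1) * norm (\<Psi> h x)"
        unfolding norm_mult using M2(2)[OF inR[OF True] h(1,2)] by (intro mult_right_mono) auto
      ultimately show ?thesis
        unfolding req ind by (simp add: norm_triangle_mono)
    qed
    define \<nu> where "\<nu> = L2_norm (\<Psi> h)"
    have \<Psi>0: "\<Psi> h x = 0" if "\<bar>x\<bar> > R" for x using offR[OF that] by simp
    have "(exp (- K))\<^sup>2 * ((x\<^sub>0 + h) - (x\<^sub>0 - h)) \<le> \<nu>\<^sup>2"
      unfolding \<nu>_def by (rule L2_norm_lower_bound[OF \<Psi>l \<Psi>0 low]) (use h in auto)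
    then have "exp (2 * K) * ((exp (- K))\<^sup>2 * (2 * h)) \<le> exp (2 * K) * \<nu>\<^sup>2"
      by (intro mult_left_mono) auto
    moreover have "exp (2 * K) * (exp (- K))\<^sup>2 = 1"
      by (simp add: power2_eq_square flip: exp_add)
    ultimately have lo: "2 * h \<le> exp (2 * K) * \<nu>\<^sup>2"
      by (simp flip: mult.assoc)
    then have \<nu>0: "\<nu> \<noteq> 0" using h by auto
    have "\<nu> \<ge> 0"
      unfolding \<nu>_def L2_norm_def by (intro real_sqrt_ge_zero integral_nonneg_AE) auto
    then have \<nu>pos: "\<nu> > 0" using \<nu>0 by simp
    have "(L2_norm r)\<^sup>2 \<le> 2 * (M2 * h ^ (N + 1))\<^sup>2 * \<nu>\<^sup>2 + 2 * (B * h ^ n)\<^sup>2 * ((x\<^sub>0 + \<delta>) - (x\<^sub>0 - \<delta>))"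
      unfolding \<nu>_def by (rule L2_norm_upper_bound[OF \<Psi>l \<Psi>0 rl r0 res]) (use \<delta> in simp_all)
    moreover have "h ^ n = h ^ (N + 1) * h" by (simp add: n_def)
    moreover have "(x\<^sub>0 + \<delta>) - (x\<^sub>0 - \<delta>) = 2 * \<delta>" by simp
    ultimately have "L2_norm r / \<nu> \<le> C * h ^ (N + 1)"
      unfolding C_def using lo \<nu>pos h \<delta> by (intro quotient_estimate) auto
    then show ?thesis
      using op(1) \<nu>0 unfolding opr \<nu>_def by blast
  qed
  show ?thesis
    by (rule exI[of _ h\<^sub>0], rule conjI, simp add: h\<^sub>0_def \<delta>,
        rule exI[of _ \<Psi>], rule exI[of _ C], rule ballI, rule main)
qed

text \<open>Replacing \<open>z - W\<close> by \<open>q = \<mu> + \<eta> (W x\<^sub>0 - W)\<close>, which agrees with it near \<open>x\<^sub>0\<close> and has positive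
real part everywhere, makes the principal fourth root globally regular. The imaginary part of that
root has the sign of \<open>Im q\<close>, the opposite of the sign of \<open>Im W - Im W x\<^sub>0\<close>, and multiplication by
\<open>- \<i>\<close> or \<open>\<i>\<close>, according to the direction of the sign change, turns it into a real part that is positive to
the left of \<open>x\<^sub>0\<close> and negative to the right.\<close>
theorem theorem2p3:
  fixes N :: nat and W :: "real \<Rightarrow> complex" and \<mu> x\<^sub>0 :: real and z :: complex
  assumes W_Sobolev: "W \<in> Winf_loc (N + 3)"
    and W_continuous: "continuous_on UNIV W"
    and \<mu>_pos: "\<mu> > 0"
    and sign_change:
      "\<exists>I. x\<^sub>0 \<in> interior I \<and> changes_sign_at (\<lambda>x. Im (W x) - Im (W x\<^sub>0)) x\<^sub>0 I"
    and z_eq: "z = of_real \<mu> + W x\<^sub>0"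
  shows "\<exists>h\<^sub>0>0. \<exists>\<Psi> :: real \<Rightarrow> real \<Rightarrow> complex. \<exists>C::real. \<forall>h\<in>{0<..<h\<^sub>0}.
    \<Psi> h \<in> biharmonic_dom h W \<and> L2_norm (\<Psi> h) \<noteq> 0 \<and>
    L2_norm (\<lambda>x. biharmonic_op h W (\<Psi> h) x - z * \<Psi> h x) / L2_norm (\<Psi> h) \<le> C * h ^ (N + 1)"
proof -
  have W: "sobolev (N + 3) W"
    by (rule Winf_loc_imp_sobolev[OF W_Sobolev W_continuous]) simp
  obtain I where I: "x\<^sub>0 \<in> interior I" "changes_sign_at (\<lambda>x. Im (W x) - Im (W x\<^sub>0)) x\<^sub>0 I"
    using sign_change by blast
  obtain d1 where d1: "d1 > 0" "ball x\<^sub>0 d1 \<subseteq> I"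
    using I(1) by (meson mem_interior)
  \<comment> \<open>within \<open>\<mu>\<close> of \<open>W x\<^sub>0\<close> the values of \<open>W\<close> keep \<open>z - W\<close> in the right half-plane\<close>
  have "isCont W x\<^sub>0" using W_continuous by (simp add: continuous_on_eq_continuous_at)
  then obtain d2 where d2: "d2 > 0" "\<And>x. dist x x\<^sub>0 < d2 \<Longrightarrow> dist (W x) (W x\<^sub>0) < \<mu>"
    using \<mu>_pos unfolding continuous_at_eps_delta by metis
  define \<delta> where "\<delta> = min d1 d2 / 2"
  have \<delta>: "\<delta> > 0" "2 * \<delta> \<le> d1" "2 * \<delta> \<le> d2" using d1 d2 by (auto simp: \<delta>_def)
  obtain \<eta> :: "real \<Rightarrow> real" where \<eta>: "\<And>k. sobolev k (\<lambda>x. of_real (\<eta> x))"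
    "\<And>x. \<bar>x - x\<^sub>0\<bar> \<le> \<delta> \<Longrightarrow> \<eta> x = 1" "\<And>x. \<bar>x - x\<^sub>0\<bar> \<ge> 2 * \<delta> \<Longrightarrow> \<eta> x = 0"
    "\<And>x. 0 \<le> \<eta> x" "\<And>x. \<eta> x \<le> 1"
    using smooth_cutoff[of \<delta> "2 * \<delta>" x\<^sub>0] \<delta> by auto
  define q where "q x = of_real \<mu> + of_real (\<eta> x) * (W x\<^sub>0 - W x)" for x
  have q: "sobolev (N + 3) q"
    unfolding q_def by (intro sobolev_add sobolev_mult sobolev_diff sobolev_const \<eta>(1) W)
  have qW: "q x = z - W x" if "\<bar>x - x\<^sub>0\<bar> \<le> \<delta>" for x
    using \<eta>(2)[OF that] by (simp add: q_def z_eq)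
  have pos: "Re (q x) > 0" for x
  proof (cases "\<bar>x - x\<^sub>0\<bar> < 2 * \<delta>")
    case True
    then have "cmod (W x\<^sub>0 - W x) < \<mu>"
      using d2(2)[of x] \<delta> by (simp add: dist_real_def dist_norm norm_minus_commute)
    then have "\<bar>Re (W x\<^sub>0 - W x)\<bar> < \<mu>" using abs_Re_le_cmod le_less_trans by blast
    moreover have "\<bar>\<eta> x * Re (W x\<^sub>0 - W x)\<bar> \<le> 1 * \<bar>Re (W x\<^sub>0 - W x)\<bar>"
      unfolding abs_mult using \<eta>(4,5)[of x] by (intro mult_right_mono) auto
    ultimately have "\<bar>\<eta> x * Re (W x\<^sub>0 - W x)\<bar> < \<mu>" by simp
    then show ?thesis by (simp add: q_def abs_less_iff del: minus_complex.simps)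
  next
    case False
    then show ?thesis using \<eta>(3)[of x] \<mu>_pos by (simp add: q_def)
  qed
  have Imq: "Im (q x) = - (Im (W x) - Im (W x\<^sub>0))" if "\<bar>x - x\<^sub>0\<bar> \<le> \<delta>" for x
    using qW[OF that] by (simp add: z_eq)
  have inI: "x \<in> I" if "\<bar>x - x\<^sub>0\<bar> \<le> \<delta>" for x
    using that d1(2) \<delta> by (auto simp: dist_real_def abs_minus_commute)
  define \<rho> where "\<rho> x = csqrt (csqrt (q x))" for x
  have Im\<rho>: "Im (q x) > 0 \<Longrightarrow> Im (\<rho> x) > 0" "Im (q x) < 0 \<Longrightarrow> Im (\<rho> x) < 0" for x
    using csqrt_right_half_plane[OF pos[of x]] csqrt_right_half_plane[of "csqrt (q x)"]
    by (auto simp: \<rho>_def simp del: csqrt.simps)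
  obtain \<sigma> where \<sigma>: "\<sigma> ^ 4 = 1"
    "\<And>x. x\<^sub>0 - \<delta> \<le> x \<Longrightarrow> x < x\<^sub>0 \<Longrightarrow> Re (\<sigma> * \<rho> x) > 0"
    "\<And>x. x\<^sub>0 < x \<Longrightarrow> x \<le> x\<^sub>0 + \<delta> \<Longrightarrow> Re (\<sigma> * \<rho> x) < 0"
  proof -
    have sgn: "\<bar>x - x\<^sub>0\<bar> \<le> \<delta>" "x \<in> I" if "x\<^sub>0 - \<delta> \<le> x" "x \<le> x\<^sub>0 + \<delta>" for x
      using that inI[of x] by auto
    from I(2) consider
        "\<forall>x \<in> I \<inter> {..<x\<^sub>0}. Im (W x) - Im (W x\<^sub>0) < 0" "\<forall>x \<in> I \<inter> {x\<^sub>0<..}. Im (W x) - Im (W x\<^sub>0) > 0"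
      | "\<forall>x \<in> I \<inter> {..<x\<^sub>0}. Im (W x) - Im (W x\<^sub>0) > 0" "\<forall>x \<in> I \<inter> {x\<^sub>0<..}. Im (W x) - Im (W x\<^sub>0) < 0"
      unfolding changes_sign_at_def by blast
    then show ?thesis
    proof cases
      case 1
      have "Im (\<rho> x) > 0" if "x\<^sub>0 - \<delta> \<le> x" "x < x\<^sub>0" for x
        using 1(1) sgn[of x] that \<delta> Imq[of x] by (intro Im\<rho>(1)) auto
      moreover have "Im (\<rho> x) < 0" if "x\<^sub>0 < x" "x \<le> x\<^sub>0 + \<delta>" for x
        using 1(2) sgn[of x] that \<delta> Imq[of x] by (intro Im\<rho>(2)) auto
      ultimately show ?thesis
        by (intro that[of "- \<i>"]) auto
    next
      case 2
      have "Im (\<rho> x) < 0" if "x\<^sub>0 - \<delta> \<le> x" "x < x\<^sub>0" for x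
        using 2(1) sgn[of x] that \<delta> Imq[of x] by (intro Im\<rho>(2)) auto
      moreover have "Im (\<rho> x) > 0" if "x\<^sub>0 < x" "x \<le> x\<^sub>0 + \<delta>" for x
        using 2(2) sgn[of x] that \<delta> Imq[of x] by (intro Im\<rho>(1)) auto
      ultimately show ?thesis
        by (intro that[of "\<i>"]) auto
    qed
  qed
  have q': "sobolev (Suc (Suc (N + 1))) q" using q by (simp add: numeral_3_eq_3 del: sobolev.simps)
  note root = sobolev_quartic_root[OF q' pos \<sigma>(1)]
  show ?thesis
  proof (rule quasimode_of_root[where c = "\<lambda>x. \<sigma> * \<rho> x" and q = q and \<delta> = \<delta> and x\<^sub>0 = x\<^sub>0])
    show "sobolev (N + 3) (\<lambda>x. \<sigma> * \<rho> x)" "sobolev (N + 3) (\<lambda>x. inverse (\<sigma> * \<rho> x))"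
      using root(3,4) by (simp_all add: \<rho>_def numeral_3_eq_3 del: sobolev.simps)
    show "(\<sigma> * \<rho> x) ^ 4 = q x" "\<sigma> * \<rho> x \<noteq> 0" for x
      using root(1,2)[of x] unfolding \<rho>_def by auto
  qed (use W_continuous q \<delta>(1) qW \<sigma> in auto)
qed

end
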